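(* Let $\{\mathcal{F}_j\}_{j=0}^p$ be a filtration and for $j=1,\ldots,p$ let $X_{0,j}$ be an $\mathcal{F}_j$-measurable and $V_j$ an $\mathcal{F}_{j-1}$-measurable real random variable. Assume that for some $m>2$ $$\mu_m:=\max_{1\le j\le p}\|V_j\|_m<\infty.$$ Suppose that for some constant $K$ and all $j$ $$\mathbb{E}(X_{0,j}\mid\mathcal{F}_{j-1})=0,\qquad \mathbb{E}(|X_{0,j}|^k\mid\mathcal{F}_{j-1})\le\frac{k!}{2}K^{k-2}V_j^2,\quad k=2,3,\ldots.$$ Write $X_0=(X_{0,1},\ldots,X_{0,p})^T$. If $V_1,\ldots,V_p$ are non-random, then for all $u\in\mathbb{R}^p$ with $\|u\|_2=1$ $$\|X_0^Tu\|_m\le\sqrt{2m}\,\mu_m+mK.$$ If all of $V_1,\ldots,V_p$ are $\mathcal{F}_0$-measurable, then for all $u\in\mathbb{R}^p$ with $\|u\|_2=1$ $$\|X_0^Tu\|_m\le2^{1-1/m}\sqrt{2m}\,\mu_m+2^{1-1/m}mK.$$ For general predictable $\{V_j\}_{j=1}^p$ (i.e. $V_j$ being $\mathcal{F}_{j-1}$-measurable) we have, for all $2<m_0<m$ and all $u\in\mathbb{R}^p$ with $\|u\|_2=1$, $$\|X_0^Tu\|_{m_0}\le\sqrt{\frac{2m}{m-m_0}}\left(\frac{3m\,\Gamma(m_0/2+1)}{m-m_0}\right)^{m_0/2+1}\mu_m+\big(3\,\Gamma(m_0+1)\big)^{1/m_0}K.$$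
   Context: For a real random variable $Z$ and $m\ge1$, $\|Z\|_m:=(\mathbb{E}|Z|^m)^{1/m}$. For $u\in\mathbb{R}^p$, $\|u\|_2$ is the Euclidean norm. $\Gamma$ is the Gamma function. $K$ is a positive constant. *)

theory Defs
  imports "HOL-Probability.Probability"
begin

text \<open>The norm takes values in \<^typ>\<open>ennreal\<close>: the Bochner integral of a non-integrable function
  is \<open>0\<close>, so a real-valued version would report a small norm for a variable without \<open>m\<close>-th
  moment. The case split is the extension of \<open>t \<mapsto> t powr (1 / m)\<close> to \<open>\<infinity>\<close>.\<close>

definition Lnorm :: "'a measure \<Rightarrow> real \<Rightarrow> ('a \<Rightarrow> real) \<Rightarrow> ennreal" where
  "Lnorm M m Z =
     (let I = (\<integral>\<^sup>+ x. ennreal (\<bar>Z x\<bar> powr m) \<partial>M)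
      in if I = \<infinity> then \<infinity> else ennreal (enn2real I powr (1 / m)))"

text \<open>A filtration indexed by \<open>0, \<dots>, p\<close>; \<open>F j\<close> is unconstrained for \<open>j > p\<close>. (The library locale
  \<^locale>\<open>filtration\<close> is indexed by a whole type and does not relate the \<open>F j\<close> to \<open>M\<close>.)\<close>

definition finite_filtration :: "'a measure \<Rightarrow> nat \<Rightarrow> (nat \<Rightarrow> 'a measure) \<Rightarrow> bool" where
  "finite_filtration M p F \<longleftrightarrow>
     (\<forall>j\<le>p. subalgebra M (F j)) \<and> (\<forall>i j. i \<le> j \<longrightarrow> j \<le> p \<longrightarrow> sets (F i) \<subseteq> sets (F j))"

text \<open>The moment condition uses the extended conditional expectation \<^const>\<open>nn_cond_exp\<close>, so an
  infinite conditional moment is not silently read as \<open>0\<close>. Together with square integrability of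
  \<open>V j\<close>, the case \<open>k = 2\<close> makes \<open>X j\<close> integrable, which is what \<^const>\<open>real_cond_exp\<close> needs in
  order to be the conditional expectation.\<close>

definition bernstein_mds ::
  "'a measure \<Rightarrow> nat \<Rightarrow> (nat \<Rightarrow> 'a measure) \<Rightarrow> real \<Rightarrow> (nat \<Rightarrow> 'a \<Rightarrow> real) \<Rightarrow> (nat \<Rightarrow> 'a \<Rightarrow> real) \<Rightarrow> bool"
where
  "bernstein_mds M p F K X V \<longleftrightarrow>
     (\<forall>j\<in>{1..p}.
        (AE x in M. real_cond_exp M (F (j - 1)) (X j) x = 0) \<and>
        (\<forall>k\<ge>2. AE x in M. nn_cond_exp M (F (j - 1)) (\<lambda>y. ennreal (\<bar>X j y\<bar> ^ k)) x
                   \<le> ennreal (fact k / 2 * K ^ (k - 2) * (V j x)\<^sup>2)))"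

end

theory Submission
  imports Defs
begin

text \<open>Write \<open>S = X\<^sub>0\<^sup>T u\<close> and \<open>\<sigma>\<^sup>2 = \<Sum>\<^sub>j u\<^sub>j\<^sup>2 V\<^sub>j\<^sup>2\<close>. The conditional Bernstein condition makes
  \<open>exp (l S - l\<^sup>2 \<sigma>\<^sup>2 / (2 (1 - l K)))\<close> the endpoint of a supermartingale, for every \<open>l\<close> with \<open>l K < 1\<close>
  that is known at time \<open>0\<close>; Jensen's inequality gives \<open>\<parallel>\<sigma>\<parallel>\<^sub>m \<le> \<mu>\<^sub>m\<close>.

  If \<open>\<sigma>\<close> is itself known at time \<open>0\<close>, one may choose \<open>l\<close> of order \<open>1 / (\<sigma> / \<surd>m + K)\<close>, and
  \<open>\<bar>S\<bar>\<^sup>m \<le> (m / (e l))\<^sup>m exp (l \<bar>S\<bar>)\<close> leads to \<open>\<parallel>S\<parallel>\<^sub>m \<le> \<surd>m \<mu>\<^sub>m + m K\<close>, which is stronger than both of the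
  first two claims. For predictable \<open>V\<close>, Freedman's inequality on \<open>{\<sigma> \<le> \<tau>}\<close> and Markov's inequality on
  \<open>{\<sigma> > \<tau>}\<close>, with \<open>\<tau> = \<mu>\<^sub>m exp (t / m)\<close>, show that \<open>\<bar>S\<bar>\<close> exceeds
  \<open>\<surd>(2 t) \<mu>\<^sub>m exp (t / m) + t K\<close> with probability at most \<open>3 exp (- t)\<close>. Integrating against the exponential
  distribution produces the Gamma functions, with exponent \<open>1 / m\<^sub>0\<close> instead of \<open>m\<^sub>0 / 2 + 1\<close> on a base that
  is at least \<open>1\<close>.\<close>

section \<open>Conditional exponential moments\<close>

text \<open>From the quadratic term on, \<open>y ^ k / fact k\<close> is at most its version with
  \<open>\<bar>y\<bar>\<close>. The linear term keeps its sign, so that a zero conditional mean can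
  remove it, while the remainder becomes a series of nonnegative terms.\<close>

lemma exp_remainder_abs:
  fixes y :: real
  shows "exp y \<le> 1 + y + (exp \<bar>y\<bar> - 1 - \<bar>y\<bar>)"
    and "(\<lambda>k. \<bar>y\<bar> ^ (k + 2) / fact (k + 2)) sums (exp \<bar>y\<bar> - 1 - \<bar>y\<bar>)"
proof -
  have s: "(\<lambda>k. z ^ (k + 2) / fact (k + 2)) sums (exp z - 1 - z)" for z :: real
  proof -
    have "(\<lambda>k. z ^ k / fact k) sums exp z"
      using exp_converges[of z] by (simp add: field_simps scaleR_conv_of_real)
    from sums_split_initial_segment[OF this, of 2] show ?thesis
      by (simp add: numeral_2_eq_2 algebra_simps)
  qed
  show "(\<lambda>k. \<bar>y\<bar> ^ (k + 2) / fact (k + 2)) sums (exp \<bar>y\<bar> - 1 - \<bar>y\<bar>)"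
    by (rule s)
  have "y ^ (k + 2) / fact (k + 2) \<le> \<bar>y\<bar> ^ (k + 2) / fact (k + 2)" for k
    by (intro divide_right_mono) (auto simp only: power_abs[symmetric] abs_ge_self fact_ge_zero)
  from sums_le[OF this s s] show "exp y \<le> 1 + y + (exp \<bar>y\<bar> - 1 - \<bar>y\<bar>)" by simp
qed

text \<open>Monotone convergence: both sides have the same integral over every set of
  \<open>F\<close>, which characterises \<open>nn_cond_exp\<close>.\<close>

lemma (in sigma_finite_subalgebra) nn_cond_exp_suminf:
  assumes [measurable]: "\<And>i::nat. f i \<in> borel_measurable M"
  shows "AE x in M. (\<Sum>i. nn_cond_exp M F (f i) x) = nn_cond_exp M F (\<lambda>x. \<Sum>i. f i x) x"
proof (rule nn_cond_exp_charact)
  fix A assume A: "A \<in> sets F"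
  then have [measurable]: "A \<in> sets M" by (meson subalg subalgebra_def subsetD)
  have "(\<integral>\<^sup>+x\<in>A. (\<Sum>i. f i x) \<partial>M) = (\<integral>\<^sup>+x. (\<Sum>i. indicator A x * f i x) \<partial>M)"
    by (simp add: ennreal_suminf_cmult mult.commute)
  also have "\<dots> = (\<Sum>i. \<integral>\<^sup>+x. indicator A x * f i x \<partial>M)"
    by (rule nn_integral_suminf) simp
  also have "\<dots> = (\<Sum>i. \<integral>\<^sup>+x. indicator A x * nn_cond_exp M F (f i) x \<partial>M)"
    using A by (simp add: nn_cond_exp_intg)
  also have "\<dots> = (\<integral>\<^sup>+x. (\<Sum>i. indicator A x * nn_cond_exp M F (f i) x) \<partial>M)"
    by (rule nn_integral_suminf[symmetric]) simp
  also have "\<dots> = (\<integral>\<^sup>+x\<in>A. (\<Sum>i. nn_cond_exp M F (f i) x) \<partial>M)"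
    by (simp add: ennreal_suminf_cmult mult.commute)
  finally show "(\<integral>\<^sup>+x\<in>A. (\<Sum>i. f i x) \<partial>M) = (\<integral>\<^sup>+x\<in>A. (\<Sum>i. nn_cond_exp M F (f i) x) \<partial>M)" .
qed auto

text \<open>\<open>real_cond_exp\<close> is the difference of two extended conditional expectations
  read through \<open>enn2real\<close>, which sends \<infinity> to 0. A vanishing difference
  therefore gives equality only once both are finite, and finiteness follows from
  \<open>\<bar>X y\<bar> \<le> 1 + \<bar>X y\<bar> ^ 2\<close>.\<close>

lemma (in sigma_finite_subalgebra) nn_cond_exp_pos_eq_neg:
  assumes [measurable]: "X \<in> borel_measurable M"
    and mean: "AE x in M. real_cond_exp M F X x = 0"
    and second: "AE x in M. nn_cond_exp M F (\<lambda>y. ennreal (\<bar>X y\<bar> ^ 2)) x < \<infinity>"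
  shows "AE x in M. nn_cond_exp M F (\<lambda>y. ennreal (- X y)) x = nn_cond_exp M F (\<lambda>y. ennreal (X y)) x
     \<and> nn_cond_exp M F (\<lambda>y. ennreal (X y)) x < \<infinity>"
proof -
  have le: "AE x in M. nn_cond_exp M F (\<lambda>y. ennreal (Y y)) x \<le> nn_cond_exp M F (\<lambda>y. 1 + ennreal (\<bar>X y\<bar> ^ 2)) x"
    if [measurable]: "Y \<in> borel_measurable M" and Y: "\<And>y. Y y \<le> \<bar>X y\<bar>" for Y
  proof (rule nn_cond_exp_mono)
    have "Y y \<le> 1 + \<bar>X y\<bar>\<^sup>2" for y
    proof -
      have "0 \<le> (\<bar>X y\<bar> - 1)\<^sup>2" by simp
      then show ?thesis using Y[of y] zero_le_power2[of "X y"]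
        by (simp add: power2_diff)
    qed
    then show "AE x in M. ennreal (Y x) \<le> 1 + ennreal (\<bar>X x\<bar>\<^sup>2)"
      by (intro AE_I2) (auto simp: ennreal_plus[symmetric] ennreal_1[symmetric] intro!: ennreal_leI simp del: ennreal_1 ennreal_plus)
  qed auto
  have "AE x in M. nn_cond_exp M F (\<lambda>y. 1) x + nn_cond_exp M F (\<lambda>y. ennreal (\<bar>X y\<bar> ^ 2)) x
      = nn_cond_exp M F (\<lambda>y. 1 + ennreal (\<bar>X y\<bar> ^ 2)) x"
    by (rule nn_cond_exp_sum) auto
  moreover have "AE x in M. 1 = nn_cond_exp M F (\<lambda>y. 1) x"
    by (rule nn_cond_exp_F_meas) auto
  ultimately have fin: "AE x in M. nn_cond_exp M F (\<lambda>y. 1 + ennreal (\<bar>X y\<bar> ^ 2)) x < \<infinity>"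
    using second
  proof eventually_elim
    case (elim x)
    from elim(1)[symmetric] elim(2)[symmetric] elim(3) show ?case by simp
  qed
  have p: "AE x in M. nn_cond_exp M F (\<lambda>y. ennreal (X y)) x \<le> nn_cond_exp M F (\<lambda>y. 1 + ennreal (\<bar>X y\<bar> ^ 2)) x"
    by (rule le) auto
  have n: "AE x in M. nn_cond_exp M F (\<lambda>y. ennreal (- X y)) x \<le> nn_cond_exp M F (\<lambda>y. 1 + ennreal (\<bar>X y\<bar> ^ 2)) x"
    by (rule le) auto
  show ?thesis
    using p n fin mean
  proof eventually_elim
    case (elim x)
    let ?p = "nn_cond_exp M F (\<lambda>y. ennreal (X y)) x"
    let ?n = "nn_cond_exp M F (\<lambda>y. ennreal (- X y)) x"
    have fin: "?p < \<infinity>" "?n < \<infinity>" using elim by (auto intro: le_less_trans)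
    moreover have "enn2real ?p = enn2real ?n"
      using elim(4) by (simp add: real_cond_exp_def)
    ultimately have "?n = ?p"
      by (metis ennreal_enn2real infinity_ennreal_def)
    then show ?case using fin by simp
  qed
qed

text \<open>The moment condition bounds the terms of order at least two by a geometric series with
  ratio \<open>\<bar>\<theta> x\<bar> * K\<close>, and \<open>1 + z \<le> exp z\<close> closes the
  estimate. The factor \<open>\<theta>\<close> may be random because, being known to
  \<open>F\<close>, it can be pulled out of the conditional expectation; later this permits a random
  \<open>l\<close>.\<close>

lemma (in sigma_finite_subalgebra) nn_cond_exp_exp_bernstein:
  fixes X V \<theta> :: "'a \<Rightarrow> real"
  assumes [measurable]: "X \<in> borel_measurable M" "\<theta> \<in> borel_measurable F"
    and mean: "AE x in M. real_cond_exp M F X x = 0"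
    and moments: "\<And>k. k \<ge> 2 \<Longrightarrow> AE x in M. nn_cond_exp M F (\<lambda>y. ennreal (\<bar>X y\<bar> ^ k)) x
                   \<le> ennreal (fact k / 2 * K ^ (k - 2) * (V x)\<^sup>2)"
    and K: "K \<ge> 0" and small: "\<And>x. \<bar>\<theta> x\<bar> * K < 1"
  shows "AE x in M. nn_cond_exp M F (\<lambda>y. ennreal (exp (\<theta> y * X y))) x
           \<le> ennreal (exp ((\<theta> x)\<^sup>2 * (V x)\<^sup>2 / (2 * (1 - \<bar>\<theta> x\<bar> * K))))"
proof -
  have [measurable]: "\<theta> \<in> borel_measurable M" by (rule measurable_from_subalg[OF subalg]) simp
  let ?E = "nn_cond_exp M F"
  let ?a = "\<lambda>x. ennreal (\<theta> x)" and ?b = "\<lambda>x. ennreal (- \<theta> x)"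
  let ?p = "\<lambda>x. ennreal (X x)" and ?n = "\<lambda>x. ennreal (- X x)"
  let ?f = "\<lambda>k x. ennreal (\<bar>\<theta> x\<bar> ^ (k + 2) / fact (k + 2)) * ennreal (\<bar>X x\<bar> ^ (k + 2))"
  have "AE x in M. ?E (\<lambda>y. ennreal (\<bar>X y\<bar> ^ 2)) x < \<infinity>"
    using moments[of 2, OF order_refl] by eventually_elim (auto intro: le_less_trans)
  note cancel = nn_cond_exp_pos_eq_neg[OF assms(1) mean this]
  txt \<open>The linear term of the exponential series is split into its positive and negative part, so that
    everything stays nonnegative; the two parts have the same finite conditional expectation and cancel
    only at the end.\<close>
  have pw: "ennreal (exp (\<theta> x * X x)) + (?a x * ?n x + ?b x * ?p x)
      \<le> 1 + (?a x * ?p x + ?b x * ?n x) + (\<Sum>k. ?f k x)" for x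
  proof -
    let ?y = "\<theta> x * X x"
    have "(\<Sum>k. ?f k x) = (\<Sum>k. ennreal (\<bar>?y\<bar> ^ (k + 2) / fact (k + 2)))"
      by (simp add: ennreal_mult[symmetric] abs_mult power_mult_distrib del: fact_Suc power_Suc)
    also have "\<dots> = ennreal (exp \<bar>?y\<bar> - 1 - \<bar>?y\<bar>)"
      by (rule suminf_ennreal_eq[OF _ exp_remainder_abs(2)]) simp
    finally have s: "(\<Sum>k. ?f k x) = ennreal (exp \<bar>?y\<bar> - 1 - \<bar>?y\<bar>)" .
    have s0: "0 \<le> exp \<bar>?y\<bar> - 1 - \<bar>?y\<bar>" using exp_ge_add_one_self[of "\<bar>?y\<bar>"] by linarith
    have mult: "ennreal a * ennreal b = ennreal (max 0 a * max 0 b)" for a b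
      by (simp add: ennreal_mult)
    have "?a x * ?n x + ?b x * ?p x = ennreal (max 0 (\<theta> x) * max 0 (- X x) + max 0 (- \<theta> x) * max 0 (X x))"
      unfolding mult by (rule ennreal_plus[symmetric]) auto
    also have "max 0 (\<theta> x) * max 0 (- X x) + max 0 (- \<theta> x) * max 0 (X x) = max 0 (- ?y)"
      by (auto simp: max_def not_le mult_le_0_iff zero_le_mult_iff)
    finally have yn: "?a x * ?n x + ?b x * ?p x = ennreal (max 0 (- ?y))" .
    have "?a x * ?p x + ?b x * ?n x = ennreal (max 0 (\<theta> x) * max 0 (X x) + max 0 (- \<theta> x) * max 0 (- X x))"
      unfolding mult by (rule ennreal_plus[symmetric]) auto
    also have "max 0 (\<theta> x) * max 0 (X x) + max 0 (- \<theta> x) * max 0 (- X x) = max 0 ?y"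
      by (auto simp: max_def not_le mult_le_0_iff zero_le_mult_iff)
    finally have yp: "?a x * ?p x + ?b x * ?n x = ennreal (max 0 ?y)" .
    have "exp ?y + max 0 (- ?y) \<le> 1 + max 0 ?y + (exp \<bar>?y\<bar> - 1 - \<bar>?y\<bar>)"
      using exp_remainder_abs(1)[of ?y] by (auto simp: max_def)
    then have "ennreal (exp ?y + max 0 (- ?y)) \<le> ennreal (1 + max 0 ?y + (exp \<bar>?y\<bar> - 1 - \<bar>?y\<bar>))"
      by (rule ennreal_leI)
    also have "ennreal (exp ?y + max 0 (- ?y)) = ennreal (exp ?y) + ennreal (max 0 (- ?y))"
      by (rule ennreal_plus) auto
    also have "ennreal (1 + max 0 ?y + (exp \<bar>?y\<bar> - 1 - \<bar>?y\<bar>))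
        = 1 + ennreal (max 0 ?y) + ennreal (exp \<bar>?y\<bar> - 1 - \<bar>?y\<bar>)"
      using s0 by (subst ennreal_plus, simp, simp, subst ennreal_plus) auto
    finally show ?thesis unfolding s yn yp .
  qed
  have "AE x in M. ?E (\<lambda>x. ennreal (exp (\<theta> x * X x)) + (?a x * ?n x + ?b x * ?p x)) x
      \<le> ?E (\<lambda>x. 1 + (?a x * ?p x + ?b x * ?n x) + (\<Sum>k. ?f k x)) x"
    by (rule nn_cond_exp_mono) (use pw in auto)
  moreover have "AE x in M. ?E (\<lambda>x. ennreal (exp (\<theta> x * X x))) x + ?E (\<lambda>x. ?a x * ?n x + ?b x * ?p x) x
    = ?E (\<lambda>x. ennreal (exp (\<theta> x * X x)) + (?a x * ?n x + ?b x * ?p x)) x"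
    by (rule nn_cond_exp_sum) auto
  moreover have "AE x in M. ?E (\<lambda>x. ?a x * ?n x) x + ?E (\<lambda>x. ?b x * ?p x) x = ?E (\<lambda>x. ?a x * ?n x + ?b x * ?p x) x"
    by (rule nn_cond_exp_sum) auto
  moreover have "AE x in M. ?E (\<lambda>x. ?a x * ?p x) x + ?E (\<lambda>x. ?b x * ?n x) x = ?E (\<lambda>x. ?a x * ?p x + ?b x * ?n x) x"
    by (rule nn_cond_exp_sum) auto
  moreover have "AE x in M. ?a x * ?E ?n x = ?E (\<lambda>x. ?a x * ?n x) x"
    by (rule nn_cond_exp_prod) auto
  moreover have "AE x in M. ?a x * ?E ?p x = ?E (\<lambda>x. ?a x * ?p x) x"
    by (rule nn_cond_exp_prod) auto
  moreover have "AE x in M. ?b x * ?E ?n x = ?E (\<lambda>x. ?b x * ?n x) x"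
    by (rule nn_cond_exp_prod) auto
  moreover have "AE x in M. ?b x * ?E ?p x = ?E (\<lambda>x. ?b x * ?p x) x"
    by (rule nn_cond_exp_prod) auto
  moreover have "AE x in M. ?E (\<lambda>x. 1 + (?a x * ?p x + ?b x * ?n x)) x + ?E (\<lambda>x. \<Sum>k. ?f k x) x
      = ?E (\<lambda>x. 1 + (?a x * ?p x + ?b x * ?n x) + (\<Sum>k. ?f k x)) x"
    by (rule nn_cond_exp_sum) auto
  moreover have "AE x in M. ?E (\<lambda>x. 1) x + ?E (\<lambda>x. ?a x * ?p x + ?b x * ?n x) x
      = ?E (\<lambda>x. 1 + (?a x * ?p x + ?b x * ?n x)) x"
    by (rule nn_cond_exp_sum) auto
  moreover have "AE x in M. 1 = ?E (\<lambda>x. 1) x"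
    by (rule nn_cond_exp_F_meas) auto
  moreover have "AE x in M. (\<Sum>k. ?E (?f k) x) = ?E (\<lambda>x. \<Sum>k. ?f k x) x"
    by (rule nn_cond_exp_suminf) auto
  \<comment> \<open>The factorial in the moment condition cancels the one in the exponential series.
    One null set serves all of the countably many \<open>k\<close>.\<close>
  moreover have "AE x in M. \<forall>k. ?E (?f k) x \<le> ennreal ((\<theta> x)\<^sup>2 * (V x)\<^sup>2 / 2 * (\<bar>\<theta> x\<bar> * K) ^ k)"
    unfolding AE_all_countable
  proof
    fix k
    have "AE x in M. ennreal (\<bar>\<theta> x\<bar> ^ (k + 2) / fact (k + 2)) * ?E (\<lambda>x. ennreal (\<bar>X x\<bar> ^ (k + 2))) x = ?E (?f k) x"
      by (rule nn_cond_exp_prod) auto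
    with moments[of "k + 2", OF le_add2]
    show "AE x in M. ?E (?f k) x \<le> ennreal ((\<theta> x)\<^sup>2 * (V x)\<^sup>2 / 2 * (\<bar>\<theta> x\<bar> * K) ^ k)"
    proof eventually_elim
      case (elim x)
      have "?E (?f k) x \<le> ennreal (\<bar>\<theta> x\<bar> ^ (k + 2) / fact (k + 2)) * ennreal (fact (k + 2) / 2 * K ^ (k + 2 - 2) * (V x)\<^sup>2)"
        unfolding elim(2)[symmetric] by (rule mult_left_mono[OF elim(1)]) simp
      also have "\<dots> = ennreal (\<bar>\<theta> x\<bar> ^ (k + 2) / fact (k + 2) * (fact (k + 2) / 2 * K ^ (k + 2 - 2) * (V x)\<^sup>2))"
        using K by (intro ennreal_mult[symmetric]) auto
      also have "\<bar>\<theta> x\<bar> ^ (k + 2) / fact (k + 2) * (fact (k + 2) / 2 * K ^ (k + 2 - 2) * (V x)\<^sup>2)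
          = (\<theta> x)\<^sup>2 * (V x)\<^sup>2 / 2 * (\<bar>\<theta> x\<bar> * K) ^ k"
        by (simp del: fact_Suc add: power_mult_distrib power_add power2_eq_square)
      finally show ?case .
    qed
  qed
  ultimately show ?thesis using cancel
  proof eventually_elim
    case (elim x)
    let ?q = "\<bar>\<theta> x\<bar> * K" and ?c = "(\<theta> x)\<^sup>2 * (V x)\<^sup>2 / 2"
    have q: "0 \<le> ?q" "?q < 1" using K small by auto
    have "(\<Sum>k. ?E (?f k) x) \<le> (\<Sum>k. ennreal (?c * ?q ^ k))"
      using elim(13) by (intro suminf_le) auto
    also have "\<dots> = ennreal (?c * (1 / (1 - ?q)))"
      using q by (intro suminf_ennreal_eq sums_mult geometric_sums) auto
    finally have s: "(\<Sum>k. ?E (?f k) x) \<le> ennreal (?c * (1 / (1 - ?q)))" .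
    \<comment> \<open>Since \<open>X\<close> and \<open>- X\<close> have the same conditional
      positive part, the linear terms contribute the same amount \<open>?r\<close> on both sides. It
      is finite, so it can be cancelled in \<open>ennreal\<close>.\<close>
    let ?r = "?a x * ?E ?p x + ?b x * ?E ?p x"
    have "?E (\<lambda>x. ennreal (exp (\<theta> x * X x))) x + ?r
        \<le> 1 + ?r + (\<Sum>k. ?E (?f k) x)"
      using elim by (auto simp: algebra_simps)
    also have "\<dots> \<le> 1 + ?r + ennreal (?c * (1 / (1 - ?q)))"
      by (rule add_left_mono[OF s])
    finally have "?r + ?E (\<lambda>x. ennreal (exp (\<theta> x * X x))) x \<le> ?r + (1 + ennreal (?c * (1 / (1 - ?q))))"
      by (simp add: algebra_simps)
    moreover have "?r < \<infinity>" using elim(14) by (auto simp: ennreal_mult_less_top)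
    ultimately have "?E (\<lambda>x. ennreal (exp (\<theta> x * X x))) x \<le> 1 + ennreal (?c * (1 / (1 - ?q)))"
      by (auto simp: ennreal_add_left_cancel_le)
    also have "\<dots> = ennreal (1 + ?c * (1 / (1 - ?q)))"
      using q by (subst ennreal_plus) auto
    also have "\<dots> \<le> ennreal (exp (?c * (1 / (1 - ?q))))"
      by (intro ennreal_leI exp_ge_add_one_self)
    also have "?c * (1 / (1 - ?q)) = (\<theta> x)\<^sup>2 * (V x)\<^sup>2 / (2 * (1 - ?q))" by simp
    finally show ?case .
  qed
qed

section \<open>Moments and tails\<close>

text \<open>Positive points are covered by \<open>powr_convex\<close>. If one of the points is 0,
  the claim reduces to \<open>s powr p \<le> s\<close> for \<open>s\<close> between 0 and 1.\<close>

lemma convex_on_powr_nonneg: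
  fixes p :: real
  assumes "p \<ge> 1"
  shows "convex_on {0..} (\<lambda>x. x powr p)"
proof (intro convex_onI)
  fix t x y :: real
  assume t: "0 < t" "t < 1" and xy: "x \<in> {0..}" "y \<in> {0..}"
  have mono: "s powr p \<le> s" if "0 < s" "s < 1" for s :: real
    using powr_mono'[of 1 p s] assms that by simp
  consider "x = 0" | "y = 0" | "x > 0" "y > 0" using xy by fastforce
  then show "((1 - t) *\<^sub>R x + t *\<^sub>R y) powr p \<le> (1 - t) * x powr p + t * y powr p"
  proof cases
    case 1
    then show ?thesis using t xy mono[of t] by (simp add: powr_mult mult_right_mono)
  next
    case 2
    then show ?thesis using t xy mono[of "1 - t"] by (simp add: powr_mult mult_right_mono)
  next
    case 3
    then show ?thesis using convex_onD[OF powr_convex[OF assms], of t x y] t by simp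
  qed
qed simp

text \<open>This is Minkowski's inequality, with the norms replaced by positive bounds
  \<open>A\<close> and \<open>B\<close> and everything kept at the power \<open>p\<close>.\<close>

lemma nn_integral_powr_add_le:
  fixes f g :: "'a \<Rightarrow> real"
  assumes [measurable]: "f \<in> borel_measurable M" "g \<in> borel_measurable M"
    and nonneg: "\<And>x. 0 \<le> f x" "\<And>x. 0 \<le> g x"
    and p: "p \<ge> 1" and AB: "A > 0" "B > 0"
    and f: "(\<integral>\<^sup>+x. ennreal (f x powr p) \<partial>M) \<le> ennreal (A powr p)"
    and g: "(\<integral>\<^sup>+x. ennreal (g x powr p) \<partial>M) \<le> ennreal (B powr p)"
  shows "(\<integral>\<^sup>+x. ennreal ((f x + g x) powr p) \<partial>M) \<le> ennreal ((A + B) powr p)"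
proof -
  txt \<open>Convexity at the point that divides \<open>f x / A\<close> and \<open>g x / B\<close> in the ratio \<open>B : A\<close>.\<close>
  define t where "t = B / (A + B)"
  have t: "0 < t" "t < 1" "1 - t = A / (A + B)" using AB by (auto simp: t_def field_simps)
  have At: "(A + B) * (1 - t) = A" "(A + B) * t = B" using AB unfolding t(3) by (simp_all add: t_def)
  define a where "a = (A + B) powr p * ((1 - t) / A powr p)"
  define b where "b = (A + B) powr p * (t / B powr p)"
  have ab: "0 \<le> a" "0 \<le> b" using t(1,2) by (auto simp: a_def b_def)
  have "(f x + g x) powr p \<le> a * f x powr p + b * g x powr p" for x
  proof -
    have "f x + g x = (A + B) * ((1 - t) * (f x / A) + t * (g x / B))"
      using AB by (simp add: distrib_left mult.assoc[symmetric] At)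
    then have "(f x + g x) powr p = (A + B) powr p * ((1 - t) * (f x / A) + t * (g x / B)) powr p"
      using AB t nonneg[of x] by (simp only: powr_mult)
    also have "\<dots> \<le> (A + B) powr p * ((1 - t) * (f x / A) powr p + t * (g x / B) powr p)"
      using convex_onD[OF convex_on_powr_nonneg[OF p], of t "f x / A" "g x / B"] t AB nonneg[of x]
      by (intro mult_left_mono) auto
    also have "\<dots> = a * f x powr p + b * g x powr p"
      using AB nonneg[of x] by (simp add: powr_divide a_def b_def algebra_simps)
    finally show ?thesis .
  qed
  then have "(\<integral>\<^sup>+x. ennreal ((f x + g x) powr p) \<partial>M)
      \<le> (\<integral>\<^sup>+x. ennreal (a * f x powr p + b * g x powr p) \<partial>M)"
    by (intro nn_integral_mono ennreal_leI)
  also have "\<dots> = (\<integral>\<^sup>+x. ennreal a * ennreal (f x powr p) + ennreal b * ennreal (g x powr p) \<partial>M)"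
    using ab by (intro nn_integral_cong) (simp add: ennreal_mult)
  also have "\<dots> = ennreal a * (\<integral>\<^sup>+x. ennreal (f x powr p) \<partial>M) + ennreal b * (\<integral>\<^sup>+x. ennreal (g x powr p) \<partial>M)"
    by (simp add: nn_integral_add nn_integral_cmult)
  also have "\<dots> \<le> ennreal a * ennreal (A powr p) + ennreal b * ennreal (B powr p)"
    by (intro add_mono mult_left_mono f g) auto
  also have "\<dots> = ennreal (a * A powr p + b * B powr p)"
    using ab by (simp add: ennreal_mult)
  also have "a * A powr p + b * B powr p = (A + B) powr p"
    using AB by (simp add: a_def b_def field_simps)
  finally show ?thesis .
qed

text \<open>Both sides fail when the integral is infinite; otherwise \<open>powr m\<close> and
  \<open>powr (1 / m)\<close> are monotone and inverse to each other. This moves the argument from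
  norms to integrals of powers.\<close>

lemma Lnorm_le_iff:
  assumes "c \<ge> 0" "m > 0"
  shows "Lnorm M m Z \<le> ennreal c \<longleftrightarrow> (\<integral>\<^sup>+x. ennreal (\<bar>Z x\<bar> powr m) \<partial>M) \<le> ennreal (c powr m)"
proof (cases "\<integral>\<^sup>+x. ennreal (\<bar>Z x\<bar> powr m) \<partial>M")
  case (real r)
  have "r powr (1 / m) \<le> c \<longleftrightarrow> r \<le> c powr m"
  proof
    assume "r powr (1 / m) \<le> c"
    then have "(r powr (1 / m)) powr m \<le> c powr m" using assms by (intro powr_mono2) auto
    then show "r \<le> c powr m" using assms real by (simp add: powr_powr)
  next
    assume "r \<le> c powr m"
    then have "r powr (1 / m) \<le> (c powr m) powr (1 / m)" using assms real by (intro powr_mono2) auto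
    then show "r powr (1 / m) \<le> c" using assms by (simp add: powr_powr)
  qed
  then show ?thesis using real assms by (simp add: Lnorm_def)
qed (simp add: Lnorm_def top_unique)

text \<open>The moment bounds are proved for real \<open>\<nu> > 0\<close> strictly above \<mu>;
  letting \<nu> decrease to \<mu> gives the bound with \<mu> itself, also when \<mu> is 0.\<close>

lemma ennreal_le_affine_limit:
  fixes a b :: real and \<mu> y :: ennreal
  assumes "a \<ge> 0" "b \<ge> 0" "\<mu> < \<infinity>"
    and *: "\<And>\<nu>. \<nu> > 0 \<Longrightarrow> \<mu> < ennreal \<nu> \<Longrightarrow> y \<le> ennreal (a * \<nu> + b)"
  shows "y \<le> ennreal a * \<mu> + ennreal b"
proof (rule ennreal_le_epsilon)
  fix e :: real assume e: "e > 0"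
  obtain r where r: "\<mu> = ennreal r" "r \<ge> 0" using assms(3) by (cases \<mu>) auto
  \<comment> \<open>Dividing by \<open>a + 1\<close> instead of \<open>a\<close> covers
    \<open>a = 0\<close>.\<close>
  define \<nu> where "\<nu> = r + e / (a + 1)"
  have d: "e / (a + 1) > 0" using e assms by simp
  have "y \<le> ennreal (a * \<nu> + b)"
    using r d by (intro *) (auto simp: \<nu>_def ennreal_less_iff)
  also have "a * \<nu> + b \<le> a * r + b + e"
  proof -
    have "a * (e / (a + 1)) \<le> e" using e assms by (simp add: field_simps)
    then show ?thesis by (simp add: \<nu>_def algebra_simps)
  qed
  then have "ennreal (a * \<nu> + b) \<le> ennreal (a * r + b + e)" by (rule ennreal_leI)
  also have "\<dots> = ennreal a * \<mu> + ennreal b + ennreal e"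
    using assms r e by (simp add: ennreal_mult)
  finally show "y \<le> ennreal a * \<mu> + ennreal b + ennreal e" .
qed

section \<open>Integration of tails, Gamma integrals and elementary power bounds\<close>

text \<open>The value \<open>f x\<close> is the length of the interval from 0 to \<open>f x\<close>;
  Tonelli's theorem exchanges the two integrals.\<close>

lemma nn_integral_layer_cake:
  assumes "sigma_finite_measure M" and [measurable]: "f \<in> borel_measurable M" and "\<And>x. 0 \<le> f x"
  shows "(\<integral>\<^sup>+x. ennreal (f x) \<partial>M) = (\<integral>\<^sup>+y. indicator {0<..} y * emeasure M {x\<in>space M. y < f x} \<partial>lborel)"
proof -
  interpret sigma_finite_measure M by fact
  interpret pair_sigma_finite M lborel ..
  have "(\<integral>\<^sup>+x. ennreal (f x) \<partial>M) = (\<integral>\<^sup>+x. (\<integral>\<^sup>+y. indicator {0<..<f x} y \<partial>lborel) \<partial>M)"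
    using assms(3) by (intro nn_integral_cong) simp
  also have "\<dots> = (\<integral>\<^sup>+x. (\<integral>\<^sup>+y. (if 0 < y \<and> y < f x then 1 else 0) \<partial>lborel) \<partial>M)"
    by (intro nn_integral_cong) (auto simp: indicator_def)
  also have "\<dots> = (\<integral>\<^sup>+y. (\<integral>\<^sup>+x. (if 0 < y \<and> y < f x then 1 else 0) \<partial>M) \<partial>lborel)"
    by (rule Fubini'[symmetric]) measurable
  also have "\<dots> = (\<integral>\<^sup>+y. indicator {0<..} y * emeasure M {x\<in>space M. y < f x} \<partial>lborel)"
  proof (rule nn_integral_cong)
    fix y :: real
    have "(\<integral>\<^sup>+x. (if 0 < y \<and> y < f x then 1 else 0) \<partial>M)
        = (\<integral>\<^sup>+x. indicator {0<..} y * indicator {x\<in>space M. y < f x} x \<partial>M)"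
      by (intro nn_integral_cong) (auto simp: indicator_def)
    then show "(\<integral>\<^sup>+x. (if 0 < y \<and> y < f x then 1 else 0) \<partial>M) = indicator {0<..} y * emeasure M {x\<in>space M. y < f x}"
      by (simp add: nn_integral_cmult)
  qed
  finally show ?thesis .
qed

text \<open>Domination of tails up to a constant passes to integrals layer by layer. It will be used
  with \<open>C = 3\<close> and an exponential law for \<open>N\<close>.\<close>

lemma nn_integral_le_of_emeasure_gt_le:
  assumes "sigma_finite_measure M" "sigma_finite_measure N"
    and [measurable]: "f \<in> borel_measurable M" "g \<in> borel_measurable N"
    and nonneg: "\<And>x. 0 \<le> f x" "\<And>x. 0 \<le> g x"
    and le: "\<And>y. y > 0 \<Longrightarrow> emeasure M {x\<in>space M. y < f x} \<le> C * emeasure N {x\<in>space N. y < g x}"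
  shows "(\<integral>\<^sup>+x. ennreal (f x) \<partial>M) \<le> C * (\<integral>\<^sup>+x. ennreal (g x) \<partial>N)"
proof -
  interpret N: sigma_finite_measure N by fact
  have [measurable]: "(\<lambda>y. emeasure N {x\<in>space N. y < g x}) \<in> borel_measurable borel"
    by measurable
  have "(\<integral>\<^sup>+x. ennreal (f x) \<partial>M) = (\<integral>\<^sup>+y. indicator {0<..} y * emeasure M {x\<in>space M. y < f x} \<partial>lborel)"
    by (rule nn_integral_layer_cake) (use assms in auto)
  also have "\<dots> \<le> (\<integral>\<^sup>+y. C * (indicator {0<..} y * emeasure N {x\<in>space N. y < g x}) \<partial>lborel)"
    using le by (intro nn_integral_mono) (auto simp: indicator_def)
  also have "\<dots> = C * (\<integral>\<^sup>+y. indicator {0<..} y * emeasure N {x\<in>space N. y < g x} \<partial>lborel)"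
    by (rule nn_integral_cmult) measurable
  also have "\<dots> = C * (\<integral>\<^sup>+x. ennreal (g x) \<partial>N)"
    by (subst nn_integral_layer_cake) (use assms in auto)
  finally show ?thesis .
qed

text \<open>The substitution of \<open>c * t\<close> for \<open>t\<close> in the Gamma
  integral.\<close>

lemma nn_integral_powr_exp:
  fixes a c :: real
  assumes "a > -1" "c > 0"
  shows "(\<integral>\<^sup>+t. ennreal (indicator {0..} t * (t powr a * exp (- c * t))) \<partial>lborel)
    = ennreal (Gamma (a + 1) / c powr (a + 1))"
proof -
  have G: "(\<integral>\<^sup>+t. ennreal (indicator {0..} t * (t powr a * exp (- t))) \<partial>lborel) = ennreal (Gamma (a + 1))"
    using Gamma_conv_nn_integral_real[of "a + 1"] assms by (simp add: exp_minus field_simps)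
  have "(\<integral>\<^sup>+t. ennreal (indicator {0..} t * (t powr a * exp (- t))) \<partial>lborel)
      = \<bar>c\<bar> * (\<integral>\<^sup>+t. ennreal (indicator {0..} (0 + c * t) * ((0 + c * t) powr a * exp (- (0 + c * t)))) \<partial>lborel)"
    using assms by (intro nn_integral_real_affine) auto
  also have "\<dots> = (\<integral>\<^sup>+t. ennreal (c powr (a + 1)) * ennreal (indicator {0..} t * (t powr a * exp (- c * t))) \<partial>lborel)"
    using assms
    by (subst nn_integral_cmult[symmetric])
       (auto intro!: nn_integral_cong simp: ennreal_mult[symmetric] indicator_def zero_le_mult_iff powr_mult powr_add algebra_simps)
  also have "\<dots> = ennreal (c powr (a + 1)) * (\<integral>\<^sup>+t. ennreal (indicator {0..} t * (t powr a * exp (- c * t))) \<partial>lborel)" (is "_ = _ * ?I")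
    by (rule nn_integral_cmult) measurable
  finally have "ennreal (c powr (a + 1)) * ?I = ennreal (Gamma (a + 1))" using G by simp
  moreover have "Gamma (a + 1) > 0" using assms by (intro Gamma_real_pos) auto
  ultimately have "?I = ennreal (Gamma (a + 1)) / ennreal (c powr (a + 1))"
    using assms by (metis ennreal_mult_divide_eq ennreal_neq_top ennreal_less_zero_iff less_numeral_extra(3) mult.commute powr_gt_zero)
  then show ?thesis using assms \<open>Gamma (a + 1) > 0\<close> by (simp add: divide_ennreal)
qed

text \<open>The function \<open>z powr m * exp (- z)\<close> is largest at \<open>z = m\<close>. The
  inequality is \<open>1 + x \<le> exp x\<close> at \<open>x = z / m - 1\<close>, raised to the
  power \<open>m\<close>.\<close>

lemma powr_le_exp:
  fixes z m :: real
  assumes "0 \<le> z" "0 < m"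
  shows "z powr m \<le> (m / exp 1) powr m * exp z"
proof -
  have "z / m \<le> exp (z / m - 1)"
    using exp_ge_add_one_self[of "z / m - 1"] by simp
  then have "z \<le> exp (z / m - 1) * m"
    using assms by (simp only: pos_divide_le_eq)
  then have "z \<le> m / exp 1 * exp (z / m)"
    by (simp add: exp_diff mult.commute)
  then have "z powr m \<le> (m / exp 1 * exp (z / m)) powr m"
    using assms by (intro powr_mono2) auto
  also have "\<dots> = (m / exp 1) powr m * exp z"
    using assms by (subst powr_mult) (auto simp: exp_powr_real)
  finally show ?thesis .
qed

text \<open>Jensen's inequality for the power \<open>m / 2\<close>, with weights
  \<open>(u j)^2\<close> at the points \<open>(v j)^2\<close>.\<close>

lemma powr_weighted_sum_squares_le:
  fixes u v :: "nat \<Rightarrow> real"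
  assumes "m \<ge> 2" "finite J" "(\<Sum>j\<in>J. (u j)\<^sup>2) = 1"
  shows "(sqrt (\<Sum>j\<in>J. (u j * v j)\<^sup>2)) powr m \<le> (\<Sum>j\<in>J. (u j)\<^sup>2 * \<bar>v j\<bar> powr m)"
proof -
  have "J \<noteq> {}" using assms(3) by auto
  have "(sqrt (\<Sum>j\<in>J. (u j * v j)\<^sup>2)) powr m = (\<Sum>j\<in>J. (u j * v j)\<^sup>2) powr (m / 2)"
    by (simp add: powr_half_sqrt[symmetric] sum_nonneg powr_powr)
  also have "\<dots> = (\<Sum>j\<in>J. (u j)\<^sup>2 *\<^sub>R (v j)\<^sup>2) powr (m / 2)"
    by (simp add: power_mult_distrib)
  also have "\<dots> \<le> (\<Sum>j\<in>J. (u j)\<^sup>2 * ((v j)\<^sup>2) powr (m / 2))"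
    by (rule convex_on_sum[OF assms(2) \<open>J \<noteq> {}\<close> convex_on_powr_nonneg]) (use assms in auto)
  also have "\<dots> = (\<Sum>j\<in>J. (u j)\<^sup>2 * \<bar>v j\<bar> powr m)"
  proof (intro sum.cong refl)
    fix j
    have "((v j)\<^sup>2) powr (m / 2) = (\<bar>v j\<bar> powr 2) powr (m / 2)" by simp
    also have "\<dots> = \<bar>v j\<bar> powr m" by (subst powr_powr) simp
    finally show "(u j)\<^sup>2 * ((v j)\<^sup>2) powr (m / 2) = (u j)\<^sup>2 * \<bar>v j\<bar> powr m" by simp
  qed
  finally show ?thesis .
qed

text \<open>It lets a bound \<open>C * exp (- s)\<close> be read as \<open>C\<close> times the tail
  of a probability law, the form that \<open>nn_integral_le_of_emeasure_gt_le\<close> asks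
  for.\<close>

lemma emeasure_exponential_gt:
  assumes "s \<ge> 0"
  shows "emeasure (density lborel (exponential_density 1)) {s<..} = ennreal (exp (- s))"
proof -
  let ?N = "density lborel (exponential_density 1)"
  interpret N: prob_space ?N by (rule prob_space_exponential_density) simp
  have "{s<..} = space ?N - {..s}" by auto
  moreover have "emeasure ?N (space ?N - {..s}) = 1 - emeasure ?N {..s}"
    by (subst emeasure_compl) (simp_all only: N.emeasure_space_1 N.emeasure_finite, simp_all)
  \<comment> \<open>The exponential law is the Erlang law with shape parameter 0.\<close>
  moreover have "emeasure ?N {..s} = ennreal (1 - exp (- s))"
    using emeasure_erlang_density[of 1 0 s] assms by (simp add: erlang_CDF_0)
  ultimately have "emeasure ?N {s<..} = 1 - ennreal (1 - exp (- s))"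
    by (simp only:)
  also have "\<dots> = ennreal (exp (- s))"
    using assms by (subst ennreal_1[symmetric], subst ennreal_minus) auto
  finally show ?thesis .
qed

text \<open>The density is absorbed into \<open>f\<close>. The identity for positive
  \<open>t\<close> is enough: the law has no mass on the negative numbers, and 0 is a null
  point.\<close>

lemma nn_integral_exponential_powr:
  assumes [measurable]: "f \<in> borel_measurable borel" and "d \<ge> 0" "a > -1" "c > 0"
    and f: "\<And>t. t > 0 \<Longrightarrow> exp (- t) * f t = d * (t powr a * exp (- c * t))"
  shows "(\<integral>\<^sup>+t. ennreal (f t) \<partial>density lborel (exponential_density 1))
    = ennreal (d * (Gamma (a + 1) / c powr (a + 1)))"
proof -
  have "(\<integral>\<^sup>+t. ennreal (f t) \<partial>density lborel (exponential_density 1))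
      = (\<integral>\<^sup>+t. ennreal (exponential_density 1 t) * ennreal (f t) \<partial>lborel)"
    by (subst nn_integral_density) auto
  also have "\<dots> = (\<integral>\<^sup>+t. ennreal d * ennreal (indicator {0..} t * (t powr a * exp (- c * t))) \<partial>lborel)"
  proof (rule nn_integral_cong_AE, use AE_lborel_singleton[of 0] in eventually_elim)
    case (elim t)
    then show ?case
      using assms(2) f[of t]
      by (cases "t > 0") (auto simp: exponential_density_def ennreal_mult'[symmetric])
  qed
  also have "\<dots> = ennreal d * ennreal (Gamma (a + 1) / c powr (a + 1))"
    using nn_integral_powr_exp[OF assms(3,4)] by (simp add: nn_integral_cmult)
  finally show ?thesis by (simp only: ennreal_mult'[OF assms(2)])
qed

section \<open>Martingale differences under the Bernstein condition\<close>

text \<open>Collects the structural hypotheses. Bounds on the moments of \<open>V\<close> stay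
  outside and are stated lemma by lemma as integral inequalities with a real bound.\<close>

locale bernstein_martingale_differences = prob_space M for M :: "'a measure" +
  fixes p :: nat and F :: "nat \<Rightarrow> 'a measure" and K :: real and X V :: "nat \<Rightarrow> 'a \<Rightarrow> real"
  assumes filtration: "finite_filtration M p F"
    and X_adapted: "\<And>j. j \<in> {1..p} \<Longrightarrow> X j \<in> borel_measurable (F j)"
    and V_predictable: "\<And>j. j \<in> {1..p} \<Longrightarrow> V j \<in> borel_measurable (F (j - 1))"
    and K_pos: "K > 0"
    and bernstein: "bernstein_mds M p F K X V"
begin

lemma subalgebra_F: "j \<le> p \<Longrightarrow> subalgebra M (F j)"
  using filtration by (simp add: finite_filtration_def)

lemma measurable_F_mono: "f \<in> measurable (F i) N \<Longrightarrow> i \<le> j \<Longrightarrow> j \<le> p \<Longrightarrow> f \<in> measurable (F j) N"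
  using filtration subalgebra_F[of i] subalgebra_F[of j]
  by (intro measurable_from_subalg[of "F j" "F i"]) (auto simp: finite_filtration_def subalgebra_def)

lemma measurable_F_M: "f \<in> measurable (F i) N \<Longrightarrow> i \<le> p \<Longrightarrow> f \<in> measurable M N"
  using measurable_from_subalg[OF subalgebra_F] .

lemma X_measurable: "j \<in> {1..p} \<Longrightarrow> X j \<in> borel_measurable M"
  using measurable_F_M[OF X_adapted] by simp

lemma V_measurable: "j \<in> {1..p} \<Longrightarrow> V j \<in> borel_measurable M"
  using measurable_F_M[OF V_predictable] by auto

section \<open>The exponential supermartingale and its variance process\<close>

text \<open>Induction on \<open>n\<close>, conditioning the last factor on \<open>F n\<close>. An
  arbitrary weight \<open>W\<close> known at time zero makes this an inequality conditional on
  \<open>F 0\<close>; it will carry the random factor that accompanies a random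
  \<open>l\<close>.\<close>

lemma exp_supermartingale:
  fixes u :: "nat \<Rightarrow> real"
  assumes u: "\<And>j. j \<in> {1..p} \<Longrightarrow> \<bar>u j\<bar> \<le> 1"
    and l[measurable]: "l \<in> borel_measurable (F 0)" and W: "W \<in> borel_measurable (F 0)"
    and l_nonneg: "\<And>x. 0 \<le> l x" and l_small: "\<And>x. l x * K < 1"
    and n: "n \<le> p"
  shows "(\<integral>\<^sup>+x. W x * ennreal (exp (\<Sum>j=1..n. l x * u j * X j x
            - (l x)\<^sup>2 * (u j * V j x)\<^sup>2 / (2 * (1 - l x * K)))) \<partial>M) \<le> (\<integral>\<^sup>+x. W x \<partial>M)"
  using n
proof (induction n)
  case 0
  then show ?case by simp
next
  case (Suc n)
  let ?d = "\<lambda>j x. (l x)\<^sup>2 * (u j * V j x)\<^sup>2 / (2 * (1 - l x * K))"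
  let ?S = "\<lambda>x. \<Sum>j=1..n. l x * u j * X j x - ?d j x"
  let ?\<theta> = "\<lambda>x. l x * u (Suc n)"
  \<comment> \<open>All that is known at time \<open>n\<close>, including the compensator of step
    \<open>Suc n\<close>, because \<open>V\<close> is predictable.\<close>
  define H where "H x = W x * ennreal (exp (?S x)) * ennreal (exp (- ?d (Suc n) x))" for x
  have j: "Suc n \<in> {1..p}" using Suc.prems by simp
  have "subalgebra M (F n)" using Suc.prems by (intro subalgebra_F) simp
  then interpret sub: finite_measure_subalgebra M "F n"
    by unfold_locales
  have [measurable]: "l \<in> borel_measurable (F n)" "W \<in> borel_measurable (F n)"
    using Suc.prems by (auto intro: measurable_F_mono[OF l] measurable_F_mono[OF W])
  have [measurable]: "X j \<in> borel_measurable (F n)" if "j \<in> {1..n}" for j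
    using Suc.prems that by (intro measurable_F_mono[OF X_adapted]) auto
  have [measurable]: "V j \<in> borel_measurable (F n)" if "j \<in> {1..Suc n}" for j
    using Suc.prems that by (intro measurable_F_mono[OF V_predictable]) auto
  have [measurable]: "X (Suc n) \<in> borel_measurable M" "l \<in> borel_measurable M"
    using X_measurable[OF j] measurable_F_M[OF l] by auto
  \<comment> \<open>Replacing \<open>\<bar>?\<theta> x\<bar>\<close> by \<open>l x\<close> gives all
    steps the same denominator, so that the compensators add up to a multiple of
    \<open>quad_var\<close>.\<close>
  have \<theta>_le: "\<bar>?\<theta> x\<bar> \<le> l x" for x
    using u[OF j] l_nonneg[of x] by (simp add: abs_mult mult_left_le)
  have \<theta>_K: "\<bar>?\<theta> x\<bar> * K \<le> l x * K" for x
    using \<theta>_le[of x] K_pos by (intro mult_right_mono) auto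
  have [measurable]: "V (Suc n) \<in> borel_measurable (F n)" by simp
  have S[measurable]: "?S \<in> borel_measurable (F n)"
    by (intro borel_measurable_sum borel_measurable_diff borel_measurable_times borel_measurable_divide borel_measurable_power) auto
  have [measurable]: "H \<in> borel_measurable (F n)"
    unfolding H_def by measurable
  have AE: "AE x in M. nn_cond_exp M (F n) (\<lambda>y. ennreal (exp (?\<theta> y * X (Suc n) y))) x
           \<le> ennreal (exp ((?\<theta> x)\<^sup>2 * (V (Suc n) x)\<^sup>2 / (2 * (1 - \<bar>?\<theta> x\<bar> * K))))"
  proof (rule sub.nn_cond_exp_exp_bernstein)
    show "AE x in M. real_cond_exp M (F n) (X (Suc n)) x = 0"
      using bernstein j unfolding bernstein_mds_def by force
    show "AE x in M. nn_cond_exp M (F n) (\<lambda>y. ennreal (\<bar>X (Suc n) y\<bar> ^ k)) x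
         \<le> ennreal (fact k / 2 * K ^ (k - 2) * (V (Suc n) x)\<^sup>2)" if "k \<ge> 2" for k
      using bernstein j that unfolding bernstein_mds_def by force
    show "\<bar>?\<theta> x\<bar> * K < 1" for x using \<theta>_K[of x] l_small[of x] by linarith
  qed (use K_pos in auto)
  have "(\<integral>\<^sup>+x. W x * ennreal (exp (\<Sum>j=1..Suc n. l x * u j * X j x - ?d j x)) \<partial>M)
      = (\<integral>\<^sup>+x. H x * ennreal (exp (?\<theta> x * X (Suc n) x)) \<partial>M)"
    by (rule nn_integral_cong)
       (simp add: H_def exp_add exp_diff exp_minus field_simps ennreal_mult[symmetric] mult.assoc)
  also have "\<dots> = (\<integral>\<^sup>+x. H x * nn_cond_exp M (F n) (\<lambda>y. ennreal (exp (?\<theta> y * X (Suc n) y))) x \<partial>M)"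
    by (rule sub.nn_cond_exp_intg[symmetric]) auto
  also have "\<dots> \<le> (\<integral>\<^sup>+x. W x * ennreal (exp (?S x)) \<partial>M)"
  proof (rule nn_integral_mono_AE, use AE in eventually_elim)
    case (elim x)
    have "(?\<theta> x)\<^sup>2 * (V (Suc n) x)\<^sup>2 / (2 * (1 - \<bar>?\<theta> x\<bar> * K)) \<le> (?\<theta> x)\<^sup>2 * (V (Suc n) x)\<^sup>2 / (2 * (1 - l x * K))"
      using \<theta>_K[of x] l_small[of x] by (intro divide_left_mono mult_pos_pos) auto
    also have "\<dots> = ?d (Suc n) x" by (simp add: power_mult_distrib)
    finally have "nn_cond_exp M (F n) (\<lambda>y. ennreal (exp (?\<theta> y * X (Suc n) y))) x \<le> ennreal (exp (?d (Suc n) x))"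
      using elim by (intro order_trans[OF elim]) (auto intro!: ennreal_leI)
    then have "H x * nn_cond_exp M (F n) (\<lambda>y. ennreal (exp (?\<theta> y * X (Suc n) y))) x \<le> H x * ennreal (exp (?d (Suc n) x))"
      by (rule mult_left_mono) simp
    also have "\<dots> = W x * ennreal (exp (?S x))"
      by (simp add: H_def mult.assoc ennreal_mult[symmetric] exp_minus)
    finally show ?case .
  qed
  also have "\<dots> \<le> (\<integral>\<^sup>+x. W x \<partial>M)"
    using Suc by simp
  finally show ?case .
qed

definition combination :: "(nat \<Rightarrow> real) \<Rightarrow> 'a \<Rightarrow> real" where
  "combination u x = (\<Sum>j=1..p. X j x * u j)"

text \<open>This is \<sigma> squared. It dominates the sum of the conditional variances of the
  \<open>u j * X j\<close>, by the moment condition with \<open>k = 2\<close>.\<close>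

definition quad_var :: "(nat \<Rightarrow> real) \<Rightarrow> 'a \<Rightarrow> real" where
  "quad_var u x = (\<Sum>j=1..p. (u j * V j x)\<^sup>2)"

lemma combination_measurable [measurable]: "combination u \<in> borel_measurable M"
  unfolding combination_def[abs_def]
  by (intro borel_measurable_sum borel_measurable_times X_measurable) auto

lemma quad_var_measurable [measurable]: "quad_var u \<in> borel_measurable M"
  unfolding quad_var_def[abs_def]
  by (intro borel_measurable_sum borel_measurable_power borel_measurable_times V_measurable) auto

lemma quad_var_nonneg: "quad_var u x \<ge> 0"
  by (simp add: quad_var_def sum_nonneg)

text \<open>Passing from \<open>u\<close> to \<open>- u\<close> flips the sum and keeps the variance
  process, so one-sided estimates yield two-sided ones.\<close>

lemma quad_var_uminus: "quad_var (\<lambda>j. - u j) = quad_var u"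
  by (simp add: quad_var_def fun_eq_iff)

lemma combination_uminus: "combination (\<lambda>j. - u j) x = - combination u x"
  by (simp add: combination_def sum_negf)

lemma exp_combination_bound:
  assumes u: "(\<Sum>j=1..p. (u j)\<^sup>2) = 1"
    and "l \<in> borel_measurable (F 0)" "W \<in> borel_measurable (F 0)"
    and "\<And>x. 0 \<le> l x" "\<And>x. l x * K < 1"
  shows "(\<integral>\<^sup>+x. W x * ennreal (exp (l x * combination u x
            - (l x)\<^sup>2 * quad_var u x / (2 * (1 - l x * K)))) \<partial>M) \<le> (\<integral>\<^sup>+x. W x \<partial>M)"
proof -
  have "\<bar>u j\<bar> \<le> 1" if "j \<in> {1..p}" for j
  proof -
    have "(u j)\<^sup>2 \<le> 1" unfolding u[symmetric] by (rule member_le_sum) (use that in auto)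
    then show ?thesis by (simp add: abs_square_le_1)
  qed
  then have "(\<integral>\<^sup>+x. W x * ennreal (exp (\<Sum>j=1..p. l x * u j * X j x
            - (l x)\<^sup>2 * (u j * V j x)\<^sup>2 / (2 * (1 - l x * K)))) \<partial>M) \<le> (\<integral>\<^sup>+x. W x \<partial>M)"
    using assms by (intro exp_supermartingale) auto
  also have "(\<lambda>x. \<Sum>j=1..p. l x * u j * X j x - (l x)\<^sup>2 * (u j * V j x)\<^sup>2 / (2 * (1 - l x * K)))
     = (\<lambda>x. l x * combination u x - (l x)\<^sup>2 * quad_var u x / (2 * (1 - l x * K)))"
    by (simp add: fun_eq_iff combination_def quad_var_def sum_subtractf sum_distrib_left sum_divide_distrib mult_ac)
  finally show ?thesis .
qed

text \<open>Jensen's inequality at each point, then integration. The weights sum to 1, so a common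
  bound on the moments of the \<open>V j\<close> carries over to \<sigma> unchanged.\<close>

lemma quad_var_moment:
  assumes u: "(\<Sum>j=1..p. (u j)\<^sup>2) = 1" and m: "m \<ge> 2"
    and V: "\<And>j. j \<in> {1..p} \<Longrightarrow> (\<integral>\<^sup>+x. ennreal (\<bar>V j x\<bar> powr m) \<partial>M) \<le> ennreal C"
    and C: "C \<ge> 0"
  shows "(\<integral>\<^sup>+x. ennreal (sqrt (quad_var u x) powr m) \<partial>M) \<le> ennreal C"
proof -
  have [measurable]: "V j \<in> borel_measurable M" if "j \<in> {1..p}" for j
    using that by (rule V_measurable)
  have "(\<integral>\<^sup>+x. ennreal (sqrt (quad_var u x) powr m) \<partial>M)
      \<le> (\<integral>\<^sup>+x. (\<Sum>j=1..p. ennreal ((u j)\<^sup>2) * ennreal (\<bar>V j x\<bar> powr m)) \<partial>M)"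
    using powr_weighted_sum_squares_le[OF m _ u]
    by (intro nn_integral_mono) (simp add: quad_var_def ennreal_mult[symmetric] sum_ennreal ennreal_leI)
  also have "\<dots> = (\<Sum>j=1..p. \<integral>\<^sup>+x. ennreal ((u j)\<^sup>2) * ennreal (\<bar>V j x\<bar> powr m) \<partial>M)"
    by (rule nn_integral_sum) measurable
  also have "\<dots> = (\<Sum>j=1..p. ennreal ((u j)\<^sup>2) * (\<integral>\<^sup>+x. ennreal (\<bar>V j x\<bar> powr m) \<partial>M))"
    by (intro sum.cong refl nn_integral_cmult) measurable
  also have "\<dots> \<le> (\<Sum>j=1..p. ennreal ((u j)\<^sup>2) * ennreal C)"
    by (intro sum_mono mult_left_mono V) auto
  also have "\<dots> = ennreal (\<Sum>j=1..p. (u j)\<^sup>2 * C)"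
    using C by (simp add: ennreal_mult[symmetric])
  also have "\<dots> = ennreal C"
    using u by (simp add: sum_distrib_right[symmetric])
  finally show ?thesis .
qed

section \<open>Moments when the variance process is known at time zero\<close>

text \<open>Write \<open>\<bar>S\<bar> = A * (l * \<bar>S\<bar>)\<close> with
  \<open>A = 1 / l\<close> and bound the power of the second factor by an exponential. The
  supermartingale with weight \<open>A powr m\<close> leaves
  \<open>2 * (m / e) powr m * exp (m / 2)\<close> times the \<open>m\<close>-th moment of
  \<open>A\<close>, which Minkowski's inequality bounds.\<close>

lemma moment_bound_initially_measurable:
  assumes u: "(\<Sum>j=1..p. (u j)\<^sup>2) = 1" and m: "m > 2" and \<nu>: "\<nu> > 0"
    and V0: "\<And>j. j \<in> {1..p} \<Longrightarrow> V j \<in> borel_measurable (F 0)"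
    and V: "\<And>j. j \<in> {1..p} \<Longrightarrow> (\<integral>\<^sup>+x. ennreal (\<bar>V j x\<bar> powr m) \<partial>M) \<le> ennreal (\<nu> powr m)"
  shows "(\<integral>\<^sup>+x. ennreal (\<bar>combination u x\<bar> powr m) \<partial>M) \<le> ennreal ((sqrt m * \<nu> + m * K) powr m)"
proof -
  define \<sigma> where "\<sigma> x = sqrt (quad_var u x)" for x
  txt \<open>The factor \<open>11/10\<close> keeps \<open>l x * K\<close> below \<open>1\<close> even where \<open>\<sigma> x = 0\<close>. It is affordable because
    \<open>2 * (1.21 / e) powr (m / 2) \<le> 1\<close>.\<close>
  define A where "A x = \<sigma> x / sqrt m + 11/10 * K" for x
  define l where "l x = 1 / A x" for x
  have \<sigma>0: "\<sigma> x \<ge> 0" for x by (simp add: \<sigma>_def quad_var_nonneg)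
  have AK: "A x \<ge> 11/10 * K" for x using \<sigma>0[of x] m by (simp add: A_def)
  have A0: "A x > 0" "A x > K" for x using AK[of x] K_pos by linarith+
  have "quad_var u \<in> borel_measurable (F 0)"
    unfolding quad_var_def[abs_def]
    by (intro borel_measurable_sum borel_measurable_power borel_measurable_times V0) auto
  then have [measurable]: "A \<in> borel_measurable (F 0)" "l \<in> borel_measurable (F 0)"
    unfolding A_def[abs_def] l_def[abs_def] \<sigma>_def[abs_def] by measurable
  have [measurable]: "A \<in> borel_measurable M" "l \<in> borel_measurable M" "\<sigma> \<in> borel_measurable M"
    unfolding A_def[abs_def] l_def[abs_def] \<sigma>_def[abs_def] by measurable
  have l: "0 \<le> l x" "l x * K < 1" for x
    using A0[of x] by (auto simp: l_def)
  \<comment> \<open>With \<open>?s = \<sigma> x / sqrt m\<close>, the left side equals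
    \<open>m / 2\<close> times the ratio of \<open>?s * ?s\<close> to
    \<open>A x * (A x - K)\<close>, and \<open>?s\<close> is at most each of these two
    factors.\<close>
  have exponent: "(l x)\<^sup>2 * quad_var u x / (2 * (1 - l x * K)) \<le> m / 2" for x
  proof -
    let ?s = "\<sigma> x / sqrt m"
    have s: "?s \<ge> 0" "A x \<ge> ?s" "A x - K \<ge> ?s" using \<sigma>0[of x] m K_pos by (auto simp: A_def)
    have "quad_var u x = m * (?s * ?s)"
      using m quad_var_nonneg[of u x] by (simp add: \<sigma>_def)
    also have "\<dots> \<le> m * (A x * (A x - K))"
      using s m A0[of x] by (intro mult_left_mono mult_mono) auto
    finally show ?thesis using A0[of x] by (simp add: l_def field_simps power2_eq_square)
  qed
  \<comment> \<open>To be applied to \<open>u\<close> and \<open>- u\<close>, which share \<sigma>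
    and hence \<open>A\<close> and \<open>l\<close>.\<close>
  have exp_bound: "(\<integral>\<^sup>+x. ennreal (A x powr m) * ennreal (exp (l x * combination w x)) \<partial>M)
      \<le> ennreal (exp (m / 2)) * (\<integral>\<^sup>+x. ennreal (A x powr m) \<partial>M)"
    if w: "(\<Sum>j=1..p. (w j)\<^sup>2) = 1" "quad_var w = quad_var u" for w
  proof -
    have "(\<integral>\<^sup>+x. ennreal (A x powr m) * ennreal (exp (l x * combination w x)) \<partial>M)
      \<le> (\<integral>\<^sup>+x. ennreal (exp (m / 2)) * (ennreal (A x powr m) * ennreal (exp (l x * combination w x
            - (l x)\<^sup>2 * quad_var w x / (2 * (1 - l x * K))))) \<partial>M)"
    proof (rule nn_integral_mono)
      fix x
      have "exp (l x * combination w x) \<le> exp (m / 2) * exp (l x * combination w x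
            - (l x)\<^sup>2 * quad_var w x / (2 * (1 - l x * K)))"
        using exponent[of x] unfolding exp_add[symmetric] w(2) by simp
      then have "A x powr m * exp (l x * combination w x) \<le> A x powr m * (exp (m / 2) * exp (l x * combination w x
            - (l x)\<^sup>2 * quad_var w x / (2 * (1 - l x * K))))"
        by (rule mult_left_mono) simp
      then show "ennreal (A x powr m) * ennreal (exp (l x * combination w x))
        \<le> ennreal (exp (m / 2)) * (ennreal (A x powr m) * ennreal (exp (l x * combination w x
            - (l x)\<^sup>2 * quad_var w x / (2 * (1 - l x * K)))))"
        by (simp add: ennreal_mult[symmetric] mult_ac ennreal_leI)
    qed
    also have "\<dots> = ennreal (exp (m / 2)) * (\<integral>\<^sup>+x. ennreal (A x powr m) * ennreal (exp (l x * combination w x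
            - (l x)\<^sup>2 * quad_var w x / (2 * (1 - l x * K)))) \<partial>M)"
      by (rule nn_integral_cmult) measurable
    also have "\<dots> \<le> ennreal (exp (m / 2)) * (\<integral>\<^sup>+x. ennreal (A x powr m) \<partial>M)"
      by (intro mult_left_mono exp_combination_bound) (use w l in auto)
    finally show ?thesis .
  qed
  let ?c = "(m / exp 1) powr m"
  have pw: "\<bar>combination u x\<bar> powr m \<le> ?c * (A x powr m * exp (l x * combination u x)
      + A x powr m * exp (l x * combination (\<lambda>j. - u j) x))" for x
  proof -
    let ?z = "\<bar>combination u x\<bar> * l x"
    have "\<bar>combination u x\<bar> = A x * ?z" using A0[of x] by (simp add: l_def)
    then have "\<bar>combination u x\<bar> powr m = (A x * ?z) powr m" by (rule arg_cong)
    also have "\<dots> = A x powr m * ?z powr m"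
      by (rule powr_mult)
    also have "\<dots> \<le> A x powr m * (?c * exp ?z)"
      using m l[of x] by (intro mult_left_mono powr_le_exp) auto
    also have "\<dots> \<le> A x powr m * (?c * (exp (l x * combination u x) + exp (l x * combination (\<lambda>j. - u j) x)))"
      by (intro mult_left_mono) (auto simp: combination_uminus abs_if mult.commute)
    finally show ?thesis by (simp add: algebra_simps)
  qed
  have "(\<integral>\<^sup>+x. ennreal (\<bar>combination u x\<bar> powr m) \<partial>M)
    \<le> (\<integral>\<^sup>+x. ennreal ?c * (ennreal (A x powr m) * ennreal (exp (l x * combination u x))
      + ennreal (A x powr m) * ennreal (exp (l x * combination (\<lambda>j. - u j) x))) \<partial>M)"
    using pw by (intro nn_integral_mono)
      (simp add: ennreal_mult[symmetric] ennreal_plus[symmetric] ennreal_leI del: ennreal_plus)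
  also have "\<dots> = ennreal ?c * ((\<integral>\<^sup>+x. ennreal (A x powr m) * ennreal (exp (l x * combination u x)) \<partial>M)
      + (\<integral>\<^sup>+x. ennreal (A x powr m) * ennreal (exp (l x * combination (\<lambda>j. - u j) x)) \<partial>M))"
    by (simp add: nn_integral_cmult nn_integral_add)
  also have "\<dots> \<le> ennreal ?c * (ennreal (exp (m / 2)) * (\<integral>\<^sup>+x. ennreal (A x powr m) \<partial>M)
      + ennreal (exp (m / 2)) * (\<integral>\<^sup>+x. ennreal (A x powr m) \<partial>M))"
    by (intro mult_left_mono add_mono exp_bound) (use u in \<open>auto simp: quad_var_uminus\<close>)
  also have "\<dots> = ennreal (2 * ?c * exp (m / 2)) * (\<integral>\<^sup>+x. ennreal (A x powr m) \<partial>M)"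
    by (simp add: ennreal_mult mult_2[symmetric] mult_ac)
  also have "(\<integral>\<^sup>+x. ennreal (A x powr m) \<partial>M) \<le> ennreal ((\<nu> / sqrt m + 11/10 * K) powr m)"
    unfolding A_def
  proof (rule nn_integral_powr_add_le)
    have "(\<integral>\<^sup>+x. ennreal ((\<sigma> x / sqrt m) powr m) \<partial>M)
        = (\<integral>\<^sup>+x. ennreal (1 / sqrt m powr m) * ennreal (\<sigma> x powr m) \<partial>M)"
      using m \<sigma>0 by (intro nn_integral_cong) (simp add: powr_divide ennreal_mult[symmetric])
    also have "\<dots> = ennreal (1 / sqrt m powr m) * (\<integral>\<^sup>+x. ennreal (\<sigma> x powr m) \<partial>M)"
      by (rule nn_integral_cmult) measurable
    also have "\<dots> \<le> ennreal (1 / sqrt m powr m) * ennreal (\<nu> powr m)"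
      unfolding \<sigma>_def by (intro mult_left_mono quad_var_moment[OF u] V) (use m in auto)
    also have "\<dots> = ennreal ((\<nu> / sqrt m) powr m)"
      using m \<nu> by (simp add: powr_divide ennreal_mult[symmetric])
    finally show "(\<integral>\<^sup>+x. ennreal ((\<sigma> x / sqrt m) powr m) \<partial>M) \<le> ennreal ((\<nu> / sqrt m) powr m)" .
  qed (use m \<nu> K_pos \<sigma>0 in \<open>auto simp: emeasure_space_1\<close>)
  then have "ennreal (2 * ?c * exp (m / 2)) * (\<integral>\<^sup>+x. ennreal (A x powr m) \<partial>M)
      \<le> ennreal (2 * ?c * exp (m / 2)) * ennreal ((\<nu> / sqrt m + 11/10 * K) powr m)"
    by (rule mult_left_mono) simp
  also have "\<dots> = ennreal (2 * ?c * exp (m / 2) * (\<nu> / sqrt m + 11/10 * K) powr m)"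
    by (simp add: ennreal_mult)
  also have "2 * ?c * exp (m / 2) * (\<nu> / sqrt m + 11/10 * K) powr m \<le> (sqrt m * \<nu> + m * K) powr m"
  proof -
    \<comment> \<open>5/2 is the value of \<open>1 + x + x^2 / 2\<close> at 1; it exceeds
      \<open>2 * (11/10)^2 = 2.42\<close>, which is what the constants below must be compared
      with.\<close>
    have e: "exp (1::real) \<ge> 5/2"
      using exp_lower_Taylor_quadratic[of 1] by (simp add: power2_eq_square)
    have "m * (\<nu> / sqrt m + 11/10 * K) = sqrt m * \<nu> + 11/10 * (m * K)"
    proof -
      have "m * (\<nu> / sqrt m) = m / sqrt m * \<nu>" by simp
      also have "\<dots> = sqrt m * \<nu>" using m by (simp add: real_div_sqrt)
      finally show ?thesis by (simp only: distrib_left)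
    qed
    also have "\<dots> \<le> 11/10 * (sqrt m * \<nu> + m * K)"
      using m \<nu> by simp
    finally have "(m * (\<nu> / sqrt m + 11/10 * K)) powr m \<le> (11/10 * (sqrt m * \<nu> + m * K)) powr m"
      using m \<nu> K_pos by (intro powr_mono2) auto
    then have 1: "m powr m * (\<nu> / sqrt m + 11/10 * K) powr m \<le> (11/10) powr m * (sqrt m * \<nu> + m * K) powr m"
      by (simp only: powr_mult)
    have "(11/10 :: real) powr 2 = 121/100" by (simp add: power2_eq_square)
    with powr_powr[of "11/10 :: real" 2 "m / 2"]
    have b: "(11/10 :: real) powr m = (121/100) powr (m / 2)" by (simp only:) simp
    have "exp (- (m / 2)) = 1 / exp 1 powr (m / 2)"
      by (simp add: exp_powr_real exp_minus inverse_eq_divide)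
    then have "2 * exp (- (m / 2)) * (11/10) powr m = 2 * (121/100 / exp 1) powr (m / 2)"
      unfolding b by (simp only: powr_divide) simp
    \<comment> \<open>The base is at most 1 and \<open>m / 2\<close> exceeds 1, so lowering the
      exponent to 1 can only increase the power.\<close>
    also have "\<dots> \<le> 2 * (121/100 / exp 1) powr 1"
    proof (intro mult_left_mono powr_mono')
      have "121/100 \<le> exp (1::real)" using e by linarith
      then show "121/100 / exp (1::real) \<le> 1" by (simp only: pos_divide_le_eq[OF exp_gt_zero] mult_1)
    qed (use m in auto)
    also have "\<dots> = (242/100) / exp 1" by simp
    also have "\<dots> \<le> 1"
    proof -
      have "242/100 \<le> exp (1::real)" using e by linarith
      then show ?thesis by (simp only: pos_divide_le_eq[OF exp_gt_zero] mult_1)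
    qed
    finally have 2: "2 * exp (- (m / 2)) * (11/10) powr m \<le> 1" .
    have "?c * exp (m / 2) = m powr m * (exp (m / 2) / exp m)"
      using m by (simp add: powr_divide exp_powr_real)
    also have "\<dots> = m powr m * exp (- (m / 2))"
      by (simp add: exp_diff[symmetric])
    finally have "?c * exp (m / 2) = m powr m * exp (- (m / 2))" .
    then have "2 * ?c * exp (m / 2) * (\<nu> / sqrt m + 11/10 * K) powr m
        = 2 * exp (- (m / 2)) * (m powr m * (\<nu> / sqrt m + 11/10 * K) powr m)" by simp
    also have "\<dots> \<le> 2 * exp (- (m / 2)) * ((11/10) powr m * (sqrt m * \<nu> + m * K) powr m)"
      by (rule mult_left_mono[OF 1]) simp
    also have "\<dots> = (2 * exp (- (m / 2)) * (11/10) powr m) * (sqrt m * \<nu> + m * K) powr m" by simp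
    also have "\<dots> \<le> 1 * (sqrt m * \<nu> + m * K) powr m"
      by (rule mult_right_mono[OF 2]) simp
    finally show ?thesis by simp
  qed
  finally show ?thesis by (simp add: ennreal_leI)
qed

section \<open>Tails and moments for a predictable variance process\<close>

text \<open>Markov's inequality for the exponential with constant \<open>l\<close> and weight 1: on
  the event the compensator is at most its value at variance \<open>\<tau>^2\<close>, so the
  exponential is at least \<open>exp t\<close> there.\<close>

lemma freedman_tail:
  assumes u: "(\<Sum>j=1..p. (u j)\<^sup>2) = 1" and "\<tau> > 0" "t \<ge> 0"
  shows "emeasure M {x \<in> space M. sqrt (2 * t) * \<tau> + t * K < combination u x \<and> quad_var u x \<le> \<tau>\<^sup>2}
    \<le> ennreal (exp (- t))"
proof -
  let ?r = "sqrt (2 * t)"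
  let ?E = "{x \<in> space M. ?r * \<tau> + t * K < combination u x \<and> quad_var u x \<le> \<tau>\<^sup>2}"
  \<comment> \<open>Chosen so that the exponent at the threshold, with variance
    \<open>\<tau>^2\<close>, is exactly \<open>t\<close>; then \<open>1 - l * K\<close> is the
    simple fraction in \<open>lK\<close>.\<close>
  define l where "l = ?r / (\<tau> + K * ?r)"
  have r: "?r \<ge> 0" "?r * ?r = 2 * t" using assms by auto
  have D: "\<tau> + K * ?r > 0" using assms K_pos r by (intro add_pos_nonneg) auto
  have l0: "l \<ge> 0" using D r by (simp add: l_def)
  have lK: "1 - l * K = \<tau> / (\<tau> + K * ?r)" using D by (simp add: l_def field_simps)
  then have lK1: "l * K < 1" using divide_pos_pos[OF assms(2) D] by linarith
  let ?h = "\<lambda>x. ennreal (exp (l * combination u x - l\<^sup>2 * quad_var u x / (2 * (1 - l * K))))"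
  have "ennreal (exp t) * emeasure M ?E = (\<integral>\<^sup>+x. ennreal (exp t) * indicator ?E x \<partial>M)"
    by (simp add: nn_integral_cmult)
  also have "\<dots> \<le> (\<integral>\<^sup>+x. ?h x \<partial>M)"
  proof (rule nn_integral_mono)
    fix x
    show "ennreal (exp t) * indicator ?E x \<le> ?h x"
    proof (cases "x \<in> ?E")
      case True
      have "t = l * (?r * \<tau> + t * K) - l\<^sup>2 * \<tau>\<^sup>2 / (2 * (1 - l * K))"
      proof -
        have "l\<^sup>2 * \<tau>\<^sup>2 / (2 * (1 - l * K)) = t * \<tau> / (\<tau> + K * ?r)"
        proof -
          have "(?r / d)\<^sup>2 * \<tau>\<^sup>2 / (2 * (\<tau> / d)) = (?r * ?r) * \<tau> / (2 * d)" if "d > 0" for d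
            using that assms(2) by (simp only: power2_eq_square) (simp add: divide_simps)
          then have "(?r / d)\<^sup>2 * \<tau>\<^sup>2 / (2 * (\<tau> / d)) = t * \<tau> / d" if "d > 0" for d
            using that unfolding r(2) by simp
          from this[OF D] show ?thesis unfolding lK unfolding l_def .
        qed
        moreover have "l * (?r * \<tau> + t * K) = (2 * t * \<tau> + t * K * ?r) / (\<tau> + K * ?r)"
          using r(2) by (simp add: l_def algebra_simps)
        ultimately have "l * (?r * \<tau> + t * K) - l\<^sup>2 * \<tau>\<^sup>2 / (2 * (1 - l * K)) = (t * (\<tau> + K * ?r)) / (\<tau> + K * ?r)"
          by (simp add: diff_divide_distrib[symmetric] algebra_simps)
        then show ?thesis using D by simp
      qed
      also have "\<dots> \<le> l * combination u x - l\<^sup>2 * quad_var u x / (2 * (1 - l * K))"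
        using True l0 lK1 by (intro diff_mono mult_left_mono divide_right_mono) auto
      finally show ?thesis using True by (simp add: ennreal_leI)
    qed simp
  qed
  also have "\<dots> \<le> (\<integral>\<^sup>+x. 1 \<partial>M)"
    using exp_combination_bound[OF u, of "\<lambda>_. l" "\<lambda>_. 1"] l0 lK1 by simp
  also have "\<dots> = 1" by (simp add: emeasure_space_1)
  finally have "ennreal (exp (- t)) * (ennreal (exp t) * emeasure M ?E) \<le> ennreal (exp (- t)) * 1"
    by (intro mult_left_mono) auto
  then show ?thesis
    by (simp add: mult.assoc[symmetric] ennreal_mult[symmetric] exp_minus)
qed

text \<open>The level \<tau> grows with \<open>t\<close> so that Markov's inequality for the
  \<open>m\<close>-th moment of \<sigma> gives exactly \<open>exp (- t)\<close>, matching Freedman's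
  bound. The factor 3 counts the upper tail, the lower tail and the event of large \<sigma>.\<close>

lemma combination_tail:
  assumes u: "(\<Sum>j=1..p. (u j)\<^sup>2) = 1" and m: "m \<ge> 2" and \<nu>: "\<nu> > 0" and t: "t \<ge> 0"
    and V: "\<And>j. j \<in> {1..p} \<Longrightarrow> (\<integral>\<^sup>+x. ennreal (\<bar>V j x\<bar> powr m) \<partial>M) \<le> ennreal (\<nu> powr m)"
  shows "emeasure M {x \<in> space M. sqrt (2 * t) * (\<nu> * exp (t / m)) + t * K < \<bar>combination u x\<bar>}
    \<le> 3 * ennreal (exp (- t))"
proof -
  define \<tau> where "\<tau> = \<nu> * exp (t / m)"
  have \<tau>: "\<tau> > 0" using \<nu> by (simp add: \<tau>_def)
  let ?x = "sqrt (2 * t) * \<tau> + t * K"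
  let ?E = "\<lambda>u. {x \<in> space M. ?x < combination u x \<and> quad_var u x \<le> \<tau>\<^sup>2}"
  let ?Q = "{x \<in> space M. \<tau>\<^sup>2 < quad_var u x}"
  have "ennreal (\<tau> powr m) * emeasure M ?Q = (\<integral>\<^sup>+x. ennreal (\<tau> powr m) * indicator ?Q x \<partial>M)"
    by (simp add: nn_integral_cmult)
  also have "\<dots> \<le> (\<integral>\<^sup>+x. ennreal (sqrt (quad_var u x) powr m) \<partial>M)"
  proof (rule nn_integral_mono)
    fix x
    show "ennreal (\<tau> powr m) * indicator ?Q x \<le> ennreal (sqrt (quad_var u x) powr m)"
    proof (cases "x \<in> ?Q")
      case True
      then have "\<tau> powr m \<le> sqrt (quad_var u x) powr m"
        using \<tau> m by (intro powr_mono2 real_le_rsqrt) auto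
      then show ?thesis using True by (simp add: ennreal_leI)
    qed simp
  qed
  also have "\<dots> \<le> ennreal (\<nu> powr m)"
    by (rule quad_var_moment[OF u m V]) auto
  finally have "ennreal (1 / \<tau> powr m) * (ennreal (\<tau> powr m) * emeasure M ?Q) \<le> ennreal (1 / \<tau> powr m) * ennreal (\<nu> powr m)"
    by (rule mult_left_mono) simp
  also have "\<dots> = ennreal (\<nu> powr m / \<tau> powr m)"
    by (simp add: ennreal_mult[symmetric])
  also have "\<nu> powr m / \<tau> powr m = exp (- t)"
    using m \<nu> by (simp add: \<tau>_def powr_mult exp_powr_real exp_minus field_simps)
  also have "ennreal (1 / \<tau> powr m) * (ennreal (\<tau> powr m) * emeasure M ?Q) = emeasure M ?Q"
    using \<tau> by (simp add: mult.assoc[symmetric] ennreal_mult[symmetric])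
  finally have Q: "emeasure M ?Q \<le> ennreal (exp (- t))" .
  have "emeasure M {x \<in> space M. ?x < \<bar>combination u x\<bar>} \<le> emeasure M (?E u \<union> ?E (\<lambda>j. - u j) \<union> ?Q)"
    by (rule emeasure_mono) (auto simp: combination_uminus quad_var_uminus abs_if split: if_splits)
  also have "\<dots> \<le> emeasure M (?E u) + emeasure M (?E (\<lambda>j. - u j)) + emeasure M ?Q"
    by (intro order_trans[OF emeasure_subadditive] add_right_mono) auto
  also have "\<dots> \<le> ennreal (exp (- t)) + ennreal (exp (- t)) + ennreal (exp (- t))"
    by (intro add_mono freedman_tail Q) (use u \<tau> t in auto)
  also have "\<dots> = 3 * ennreal (exp (- t))"
    by (simp add: ennreal_plus[symmetric] ennreal_mult'[symmetric] ennreal_numeral[symmetric] del: ennreal_plus ennreal_numeral)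
  finally show ?thesis unfolding \<tau>_def .
qed

text \<open>By \<open>combination_tail\<close>, the tail of \<open>\<bar>S\<bar>\<close> is at most
  3 times that of \<open>f T + g T\<close> for a standard exponential \<open>T\<close>. Minkowski's
  inequality separates \<open>f\<close> and \<open>g\<close>, whose moments are Gamma integrals; the
  one for \<open>f\<close> converges since \<open>q < m\<close>.\<close>

lemma moment_bound_predictable:
  assumes u: "(\<Sum>j=1..p. (u j)\<^sup>2) = 1" and m: "m > 2" and \<nu>: "\<nu> > 0"
    and q: "2 < q" "q < m"
    and V: "\<And>j. j \<in> {1..p} \<Longrightarrow> (\<integral>\<^sup>+x. ennreal (\<bar>V j x\<bar> powr m) \<partial>M) \<le> ennreal (\<nu> powr m)"
  shows "(\<integral>\<^sup>+x. ennreal (\<bar>combination u x\<bar> powr q) \<partial>M)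
    \<le> ennreal ((sqrt (2 * m / (m - q)) * (3 * m * Gamma (q / 2 + 1) / (m - q)) powr (1 / q) * \<nu>
        + (3 * Gamma (q + 1)) powr (1 / q) * K) powr q)"
proof -
  let ?N = "density lborel (exponential_density 1)"
  \<comment> \<open>\<open>max 0 t\<close> makes \<open>f\<close> and \<open>g\<close> nonnegative
    on the whole line; the exponential law lives on positive \<open>t\<close>.\<close>
  define f where "f t = sqrt (2 * max 0 t) * (\<nu> * exp (t / m))" for t
  define g where "g t = max 0 t * K" for t
  define c where "c = (m - q) / m"
  define A where "A = sqrt 2 * \<nu> * (Gamma (q / 2 + 1) / c powr (q / 2 + 1)) powr (1 / q)"
  define B where "B = K * Gamma (q + 1) powr (1 / q)"
  have c: "0 < c" using m q by (simp add: c_def)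
  have G: "Gamma (q / 2 + 1) > 0" "Gamma (q + 1) > 0" using q by (auto intro!: Gamma_real_pos)
  have [measurable]: "f \<in> borel_measurable borel" "g \<in> borel_measurable borel"
    unfolding f_def[abs_def] g_def[abs_def] by measurable
  have cont: "continuous_on S (\<lambda>t. f t + g t)" for S
    unfolding f_def g_def using m by (intro continuous_intros) auto
  have nonneg: "f t \<ge> 0" "g t \<ge> 0" for t
    using \<nu> K_pos by (auto simp: f_def g_def)
  have mono: "f s + g s < f t + g t" if "0 \<le> s" "s < t" for s t
  proof -
    have "f s \<le> f t" unfolding f_def
      using that \<nu> m by (intro mult_mono) (auto simp: divide_right_mono)
    moreover have "g s < g t" using that K_pos by (simp add: g_def)
    ultimately show ?thesis by simp
  qed
  have "(\<integral>\<^sup>+x. ennreal (\<bar>combination u x\<bar> powr q) \<partial>M) \<le> 3 * (\<integral>\<^sup>+t. ennreal ((f t + g t) powr q) \<partial>?N)"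
  proof (rule nn_integral_le_of_emeasure_gt_le)
    show "sigma_finite_measure M" by unfold_locales
    show "sigma_finite_measure ?N"
      using prob_space_exponential_density[of 1] by (simp add: prob_space_imp_sigma_finite)
    fix y :: real assume y: "y > 0"
    define z where "z = y powr (1 / q)"
    have z: "z > 0" "z powr q = y" using y q by (auto simp: z_def powr_powr)
    \<comment> \<open>\<open>s\<close> is the parameter whose tail threshold is \<open>z\<close>.
      The search can stop at \<open>z / K\<close>, where \<open>g\<close> alone reaches
      \<open>z\<close>.\<close>
    have "\<exists>s\<ge>0. s \<le> z / K \<and> f s + g s = z"
    proof (rule IVT')
      show "f 0 + g 0 \<le> z" using z by (simp add: f_def g_def)
      show "z \<le> f (z / K) + g (z / K)" using nonneg(1)[of "z / K"] z K_pos by (simp add: g_def)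
    qed (use z K_pos cont in auto)
    then obtain s where s: "s \<ge> 0" "f s + g s = z" by blast
    have "{x \<in> space M. y < \<bar>combination u x\<bar> powr q}
        = {x \<in> space M. sqrt (2 * s) * (\<nu> * exp (s / m)) + s * K < \<bar>combination u x\<bar>}"
    proof -
      have "sqrt (2 * s) * (\<nu> * exp (s / m)) + s * K = z" using s by (simp add: f_def g_def)
      moreover have "y < r powr q \<longleftrightarrow> z < r" if "r \<ge> 0" for r
        using that q z powr_mono2[of q r z] powr_less_mono2[of q z r] by (auto simp: not_le[symmetric])
      ultimately show ?thesis by auto
    qed
    then have "emeasure M {x \<in> space M. y < \<bar>combination u x\<bar> powr q} \<le> 3 * ennreal (exp (- s))"
      using combination_tail[OF u _ \<nu> s(1) V] m by simp
    also have "ennreal (exp (- s)) = emeasure ?N {s<..}"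
      by (rule emeasure_exponential_gt[symmetric, OF s(1)])
    also have "\<dots> \<le> emeasure ?N {t \<in> space ?N. y < (f t + g t) powr q}"
    proof (rule emeasure_mono)
      show "{s<..} \<subseteq> {t \<in> space ?N. y < (f t + g t) powr q}"
        using mono[OF s(1)] q z unfolding s(2) by (auto simp: powr_less_mono2 z(2)[symmetric])
    qed measurable
    finally show "emeasure M {x \<in> space M. y < \<bar>combination u x\<bar> powr q}
      \<le> 3 * emeasure ?N {t \<in> space ?N. y < (f t + g t) powr q}"
      by (simp add: mult_left_mono)
  qed auto
  also have "(\<integral>\<^sup>+t. ennreal ((f t + g t) powr q) \<partial>?N) \<le> ennreal ((A + B) powr q)"
  proof (rule nn_integral_powr_add_le)
    have "(\<integral>\<^sup>+t. ennreal (f t powr q) \<partial>?N)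
        = ennreal ((sqrt 2 * \<nu>) powr q * (Gamma (q / 2 + 1) / c powr (q / 2 + 1)))"
    proof (rule nn_integral_exponential_powr)
      fix t :: real assume t: "t > 0"
      have "sqrt t powr q = t powr (q / 2)"
        using t by (simp add: powr_half_sqrt[symmetric] powr_powr)
      \<comment> \<open>The growth of the truncation level uses up the share \<open>q / m\<close> of
        the exponential decay and leaves the rate \<open>c\<close>.\<close>
      moreover have "exp (- t) * exp (t / m * q) = exp (- c * t)"
        using m by (simp add: exp_add[symmetric] c_def field_simps)
      moreover have "f t powr q = (sqrt 2 * \<nu>) powr q * (sqrt t powr q * exp (t / m * q))"
        using t by (simp add: f_def real_sqrt_mult powr_mult exp_powr_real)
      ultimately show "exp (- t) * f t powr q = (sqrt 2 * \<nu>) powr q * (t powr (q / 2) * exp (- c * t))"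
        by (simp add: mult_ac)
    qed (use c q in auto)
    also have "(sqrt 2 * \<nu>) powr q * (Gamma (q / 2 + 1) / c powr (q / 2 + 1)) = A powr q"
      using q G c by (simp add: A_def powr_mult powr_powr)
    finally show "(\<integral>\<^sup>+t. ennreal (f t powr q) \<partial>?N) \<le> ennreal (A powr q)" by simp
    have "(\<integral>\<^sup>+t. ennreal (g t powr q) \<partial>?N) = ennreal (K powr q * (Gamma (q + 1) / 1 powr (q + 1)))"
    proof (rule nn_integral_exponential_powr)
      fix t :: real assume "t > 0"
      then show "exp (- t) * g t powr q = K powr q * (t powr q * exp (- 1 * t))"
        by (simp add: g_def powr_mult mult_ac)
    qed (use q in auto)
    also have "K powr q * (Gamma (q + 1) / 1 powr (q + 1)) = B powr q"
      using q G by (simp add: B_def powr_mult powr_powr)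
    finally show "(\<integral>\<^sup>+t. ennreal (g t powr q) \<partial>?N) \<le> ennreal (B powr q)" by simp
    show "A > 0" "B > 0" using \<nu> G c K_pos by (auto simp: A_def B_def)
  qed (use nonneg q in auto)
  then have "3 * (\<integral>\<^sup>+t. ennreal ((f t + g t) powr q) \<partial>?N) \<le> 3 * ennreal ((A + B) powr q)"
    by (rule mult_left_mono) simp
  also have "\<dots> = ennreal ((3 powr (1 / q) * A + 3 powr (1 / q) * B) powr q)"
    using q by (simp add: distrib_left[symmetric] powr_mult powr_powr ennreal_mult)
  also have "3 powr (1 / q) * B = (3 * Gamma (q + 1)) powr (1 / q) * K"
    by (simp add: B_def powr_mult)
  also have "3 powr (1 / q) * A = sqrt (2 * m / (m - q)) * (3 * m * Gamma (q / 2 + 1) / (m - q)) powr (1 / q) * \<nu>"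
  proof -
    \<comment> \<open>The exponent \<open>q / 2 + 1\<close> divided by \<open>q\<close> splits into
      \<open>1 / 2\<close>, which goes into the square root, and \<open>1 / q\<close>, which joins
      the Gamma factor.\<close>
    have "(c powr (q / 2 + 1)) powr (1 / q) = c powr (1 / 2 + 1 / q)"
      using q by (simp add: powr_powr field_simps)
    also have "\<dots> = sqrt c * c powr (1 / q)"
      using c by (simp add: powr_add powr_half_sqrt)
    finally have "3 powr (1 / q) * A = sqrt 2 / sqrt c * (3 powr (1 / q) * Gamma (q / 2 + 1) powr (1 / q) / c powr (1 / q)) * \<nu>"
      by (simp add: A_def powr_divide)
    also have "\<dots> = sqrt (2 / c) * (3 * Gamma (q / 2 + 1) / c) powr (1 / q) * \<nu>"
      by (simp add: real_sqrt_divide powr_mult powr_divide)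
    finally show ?thesis by (simp add: c_def mult_ac)
  qed
  finally show ?thesis .
qed

end

section \<open>The three claims from the two moment bounds\<close>

theorem lemma8p3:
  fixes M :: "'a measure" and p :: nat and F :: "nat \<Rightarrow> 'a measure"
    and X V :: "nat \<Rightarrow> 'a \<Rightarrow> real" and m K :: real and \<mu> :: ennreal
  assumes "prob_space M"
    and "1 \<le> p"
    and "finite_filtration M p F"
    and "\<And>j. j \<in> {1..p} \<Longrightarrow> X j \<in> borel_measurable (F j)"
    and "\<And>j. j \<in> {1..p} \<Longrightarrow> V j \<in> borel_measurable (F (j - 1))"
    and "m > 2"
    and "\<mu> = (MAX j\<in>{1..p}. Lnorm M m (V j))"
    and "\<mu> < \<infinity>"
    and "K > 0"
    and "bernstein_mds M p F K X V"
  shows "((\<forall>j\<in>{1..p}. \<exists>c. \<forall>x\<in>space M. V j x = c) \<longrightarrow>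
            (\<forall>u :: nat \<Rightarrow> real. L2_set u {1..p} = 1 \<longrightarrow>
               Lnorm M m (\<lambda>x. \<Sum>j=1..p. X j x * u j)
                 \<le> ennreal (sqrt (2 * m)) * \<mu> + ennreal (m * K))) \<and>
         ((\<forall>j\<in>{1..p}. V j \<in> borel_measurable (F 0)) \<longrightarrow>
            (\<forall>u :: nat \<Rightarrow> real. L2_set u {1..p} = 1 \<longrightarrow>
               Lnorm M m (\<lambda>x. \<Sum>j=1..p. X j x * u j)
                 \<le> ennreal (2 powr (1 - 1 / m) * sqrt (2 * m)) * \<mu>
                   + ennreal (2 powr (1 - 1 / m) * m * K))) \<and>
         (\<forall>m\<^sub>0 :: real. 2 < m\<^sub>0 \<and> m\<^sub>0 < m \<longrightarrow>
            (\<forall>u :: nat \<Rightarrow> real. L2_set u {1..p} = 1 \<longrightarrow>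
               Lnorm M m\<^sub>0 (\<lambda>x. \<Sum>j=1..p. X j x * u j)
                 \<le> ennreal (sqrt (2 * m / (m - m\<^sub>0))
                       * (3 * m * Gamma (m\<^sub>0 / 2 + 1) / (m - m\<^sub>0)) powr (m\<^sub>0 / 2 + 1)) * \<mu>
                   + ennreal ((3 * Gamma (m\<^sub>0 + 1)) powr (1 / m\<^sub>0) * K)))"
proof -
  interpret prob_space M by fact
  interpret bernstein_martingale_differences M p F K X V
    by unfold_locales (use assms in auto)
  note m = \<open>m > 2\<close>
  have comb: "(\<lambda>x. \<Sum>j=1..p. X j x * u j) = combination u" for u
    by (simp add: combination_def fun_eq_iff)
  have u2: "(\<Sum>j=1..p. (u j)\<^sup>2) = 1" if "L2_set u {1..p} = 1" for u
    using that by (simp add: L2_set_def)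
  have V\<nu>: "(\<integral>\<^sup>+x. ennreal (\<bar>V j x\<bar> powr m) \<partial>M) \<le> ennreal (\<nu> powr m)"
    if "\<nu> > 0" "\<mu> < ennreal \<nu>" "j \<in> {1..p}" for j \<nu>
  proof -
    have "Lnorm M m (V j) \<le> \<mu>"
      unfolding assms(7) using that by (intro Max_ge) auto
    then show ?thesis
      using that m by (subst Lnorm_le_iff[symmetric]) auto
  qed
  \<comment> \<open>Serves the first two claims, whose coefficients are at least
    \<open>sqrt m\<close> and \<open>m * K\<close>.\<close>
  have initial: "Lnorm M m (\<lambda>x. \<Sum>j=1..p. X j x * u j) \<le> ennreal (sqrt m) * \<mu> + ennreal (m * K)"
    if "\<And>j. j \<in> {1..p} \<Longrightarrow> V j \<in> borel_measurable (F 0)" "L2_set u {1..p} = 1" for u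
  proof (rule ennreal_le_affine_limit)
    fix \<nu> :: real assume \<nu>: "\<nu> > 0" "\<mu> < ennreal \<nu>"
    show "Lnorm M m (\<lambda>x. \<Sum>j=1..p. X j x * u j) \<le> ennreal (sqrt m * \<nu> + m * K)"
      unfolding comb
      using m \<nu> K_pos moment_bound_initially_measurable[OF u2[OF that(2)] m \<nu>(1) that(1) V\<nu>[OF \<nu>]]
      by (subst Lnorm_le_iff) auto
  qed (use m K_pos assms(8) in auto)
  have two: "1 \<le> 2 powr (1 - 1 / m)"
    using m by (intro ge_one_powr_ge_zero) auto
  have sqrt_le: "sqrt m \<le> sqrt (2 * m)" using m by simp
  show ?thesis
  proof (intro conjI impI allI)
    fix u :: "nat \<Rightarrow> real"
    assume const: "\<forall>j\<in>{1..p}. \<exists>c. \<forall>x\<in>space M. V j x = c" and u: "L2_set u {1..p} = 1"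
    \<comment> \<open>A constant function is measurable for every sigma-algebra on the same space,
      so non-random \<open>V\<close> falls under \<open>initial\<close>.\<close>
    have "V j \<in> borel_measurable (F 0)" if "j \<in> {1..p}" for j
    proof -
      obtain c where "\<forall>x\<in>space M. V j x = c" using const \<open>j \<in> {1..p}\<close> by blast
      moreover have "space (F 0) = space M" using subalgebra_F[of 0] by (simp add: subalgebra_def)
      ultimately show ?thesis by (subst measurable_cong[of _ _ "\<lambda>_. c"]) auto
    qed
    then show "Lnorm M m (\<lambda>x. \<Sum>j=1..p. X j x * u j) \<le> ennreal (sqrt (2 * m)) * \<mu> + ennreal (m * K)"
      using sqrt_le K_pos by (intro order_trans[OF initial[OF _ u]] add_mono mult_right_mono ennreal_leI) auto
  next
    fix u :: "nat \<Rightarrow> real"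
    assume V0: "\<forall>j\<in>{1..p}. V j \<in> borel_measurable (F 0)" and u: "L2_set u {1..p} = 1"
    have "sqrt m \<le> 2 powr (1 - 1 / m) * sqrt (2 * m)"
      using mult_mono[OF two sqrt_le] m by simp
    moreover have "m * K \<le> 2 powr (1 - 1 / m) * m * K"
      using mult_right_mono[OF two, of "m * K"] m K_pos by (simp add: mult.assoc)
    ultimately show "Lnorm M m (\<lambda>x. \<Sum>j=1..p. X j x * u j)
        \<le> ennreal (2 powr (1 - 1 / m) * sqrt (2 * m)) * \<mu> + ennreal (2 powr (1 - 1 / m) * m * K)"
      using V0
      by (intro order_trans[OF initial[OF _ u] add_mono[OF mult_right_mono[OF ennreal_leI] ennreal_leI]]) auto
  next
    fix m\<^sub>0 :: real and u :: "nat \<Rightarrow> real"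
    assume m0: "2 < m\<^sub>0 \<and> m\<^sub>0 < m" and u: "L2_set u {1..p} = 1"
    let ?b = "3 * m * Gamma (m\<^sub>0 / 2 + 1) / (m - m\<^sub>0)"
    let ?s = "sqrt (2 * m / (m - m\<^sub>0))" and ?B = "(3 * Gamma (m\<^sub>0 + 1)) powr (1 / m\<^sub>0) * K"
    \<comment> \<open>\<open>Gamma\<close> equals 1 at 2 and increases from there. Hence the base
      \<open>?b\<close> is at least 1, and its exponent may be raised from
      \<open>1 / m\<^sub>0\<close> to \<open>m\<^sub>0 / 2 + 1\<close>.\<close>
    have "Gamma (m\<^sub>0 / 2 + 1) > 1"
      using Gamma_real_strict_mono[of 2 "m\<^sub>0 / 2 + 1"] Gamma_fact[of 1, where 'a = real] m0 by simp
    then have "3 * m * 1 \<le> 3 * m * Gamma (m\<^sub>0 / 2 + 1)"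
      using m by (intro mult_left_mono) auto
    then have "m - m\<^sub>0 \<le> 3 * m * Gamma (m\<^sub>0 / 2 + 1)"
      using m m0 by linarith
    then have b: "?b \<ge> 1" using m0 by simp
    have "1 / m\<^sub>0 \<le> 1" using m0 by simp
    then have "1 / m\<^sub>0 \<le> m\<^sub>0 / 2 + 1" using m0 by linarith
    then have exponents: "?b powr (1 / m\<^sub>0) \<le> ?b powr (m\<^sub>0 / 2 + 1)"
      using b by (rule powr_mono)
    have "Lnorm M m\<^sub>0 (\<lambda>x. \<Sum>j=1..p. X j x * u j) \<le> ennreal (?s * ?b powr (1 / m\<^sub>0)) * \<mu> + ennreal ?B"
    proof (rule ennreal_le_affine_limit)
      fix \<nu> :: real assume \<nu>: "\<nu> > 0" "\<mu> < ennreal \<nu>"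
      show "Lnorm M m\<^sub>0 (\<lambda>x. \<Sum>j=1..p. X j x * u j) \<le> ennreal (?s * ?b powr (1 / m\<^sub>0) * \<nu> + ?B)"
        unfolding comb
        using m0 \<nu> m K_pos moment_bound_predictable[OF u2[OF u] m \<nu>(1) _ _ V\<nu>[OF \<nu>], of m\<^sub>0]
        by (subst Lnorm_le_iff) auto
    qed (use m m0 K_pos assms(8) in auto)
    also have "\<dots> \<le> ennreal (?s * ?b powr (m\<^sub>0 / 2 + 1)) * \<mu> + ennreal ?B"
      using m m0 by (intro add_mono mult_right_mono ennreal_leI mult_left_mono exponents) auto
    finally show "Lnorm M m\<^sub>0 (\<lambda>x. \<Sum>j=1..p. X j x * u j) \<le> ennreal (?s * ?b powr (m\<^sub>0 / 2 + 1)) * \<mu> + ennreal ?B" .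
  qed
qed

end
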